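(* Let $S$ be a finite set of ground equations over a finite set $C$ of constants and a finite set $F_{AC}$ of AC symbols, put into the purified flat form $S=S_C\cup\bigcup_{f\in F_{AC}}S_f$ over an extended set of constants, and let $\{\gg_f\mid f\in F_{AC}\}$ be a family of total admissible orderings on $f$-monomials extending a common total ordering $\gg_C$ on the (extended) constants, in each of which nonconstant monomials are greater than constants. Let $R_S=R_C\cup\bigcup_{f\in F_{AC}}R_f$ be the output of {\bf CombinationMultAC}$(S,\gg)$. Then $R_S$ is a canonical rewrite system associated with $ACCC(S)$ in the extended signature, such that $ACCC(R_S)$, with the rules of $R_S$ viewed as equations, restricted to the original signature is $ACCC(S)$.
   Context: Purification and flattening: nested occurrences of each AC symbol $f$ are flattened ($f(f(s_1,s_2),s_3)$ and $f(s_1,f(s_2,s_3))$ become $f(s_1,s_2,s_3)$), and every nonconstant argument of an AC term whose outermost symbol differs from the enclosing one is replaced by a fresh constant $u$ together with a new equation $t=u$ (one fresh constant per distinct subterm), repeatedly, so that the equations become: $S_C$, equations between constants, and for each $f\in F_{AC}$, $S_f$, equations between $f$-monomials. An $f$-monomial is $f(M)$ for a nonempty finite multiset $M$ of constants, a constant $c$ being identified with $f(\{\!\{c\}\!\})$; $\cup$ is multiset sum, $-$ truncated difference, $\subseteq$ sub-multiset; a rule $f(A)\rightarrow f(B)$ rewrites $f(M)$ to $f((M-A)\cup B)$ when $A\subseteq M$. Admissible ordering on $f$-monomials: total well-founded, extends $\gg_C$, $f(A)\gg_f f(B)$ when $B$ is a proper sub-multiset of $A$, and $f(A_1)\gg_f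 f(A_2)\Rightarrow f(A_1\cup B)\gg_f f(A_2\cup B)$. $ACCC(E)$ is the congruence closure of $E$ modulo associativity and commutativity of every symbol in $F_{AC}$: the smallest congruence on ground terms containing $E$ and all ground instances of $f(x,y)=f(y,x)$ and $f(x,f(y,z))=f(f(x,y),z)$ for $f\in F_{AC}$. Canonical means terminating and confluent. Subroutines: SingleACCompletion$(S_f,\gg_f)$ is the standard completion for a single AC symbol producing a reduced canonical rewrite system for $ACCC(S_f)$ by orienting equations, adding non-joinable critical pairs $(f((AB-A_1)\cup A_2),f((AB-B_1)\cup B_2))$, $AB=(A_1\cup B_1)-(A_1\cap B_1)$, and interreducing. ${\bf update_C}(R_C,N)$ merges the equivalence classes of constants of $R_C$ using the constant rules $N$, rewriting each constant to the $\gg_C$-least constant of its class. ${\bf update}_{AC}(R_f,R_C,\gg_f)$ takes the rules of $R_f$ whose left sides are reducible by $R_C$, normalizes and reorients them, and recompletes (critical pairs, interreduction) to return an updated canonical $R'_f$ for $ACCC$ of $R_f\cup R_C$, together with the set of new constant rules generated. Algorithm {\bf CombinationMultAC}$(S,\gg)$: compute the reduced canonical constant system $R_C$ from $S_C$ using $\gg_C$; $NR_C:=\emptyset$. For each $f\in F_{AC}$: replace constants in $S_f$ by their canonical forms under $R_C$, let $R_f:=$ SingleACCompletion$(S_f,\gg_f)$, and add the constant rules of $R_f$ to $NR_C$. Update $R_C$ by ${\bf update_C}(R_C,NR_C)$; if it changed, set $new:=true$. While $new$: $NNR_C:=\emptyset$; for each $R_f$ having a rule whose left side is not in canonical form w.r.t.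 $R_C$, let $(R'_f,NR_C):={\bf update}_{AC}(R_f,R_C,\gg_f)$, $R_f:=R'_f$, $NNR_C:=NNR_C\cup NR_C$; if $NNR_C=\emptyset$ set $new:=false$, else update $R_C$ by ${\bf update_C}(R_C,NNR_C)$. Return $R_S=R_C\cup\bigcup_f R_f$. *)

theory Defs
  imports Main "HOL-Library.Multiset"
begin

section \<open>Ground terms and AC congruence closure\<close>

text \<open>Every symbol is an AC symbol, hence binary.  Signatures are explicit carriers: a set
  of constants and a set of symbols.\<close>

datatype ('c, 'f) gterm = Const 'c | App 'f "('c, 'f) gterm" "('c, 'f) gterm"

inductive_set gterms :: "'c set \<Rightarrow> 'f set \<Rightarrow> ('c, 'f) gterm set"
  for C :: "'c set" and F :: "'f set" where
  const: "c \<in> C \<Longrightarrow> Const c \<in> gterms C F"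
| app: "f \<in> F \<Longrightarrow> s \<in> gterms C F \<Longrightarrow> t \<in> gterms C F \<Longrightarrow> App f s t \<in> gterms C F"

inductive_set accc ::
    "'c set \<Rightarrow> 'f set \<Rightarrow> ('c, 'f) gterm rel \<Rightarrow> ('c, 'f) gterm rel"
  for C :: "'c set" and F :: "'f set" and E :: "('c, 'f) gterm rel" where
  eqn: "(s, t) \<in> E \<Longrightarrow> s \<in> gterms C F \<Longrightarrow> t \<in> gterms C F \<Longrightarrow> (s, t) \<in> accc C F E"
| comm: "f \<in> F \<Longrightarrow> s \<in> gterms C F \<Longrightarrow> t \<in> gterms C F
    \<Longrightarrow> (App f s t, App f t s) \<in> accc C F E"
| assoc: "f \<in> F \<Longrightarrow> s \<in> gterms C F \<Longrightarrow> t \<in> gterms C F \<Longrightarrow> v \<in> gterms C F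
    \<Longrightarrow> (App f s (App f t v), App f (App f s t) v) \<in> accc C F E"
| refl: "s \<in> gterms C F \<Longrightarrow> (s, s) \<in> accc C F E"
| sym: "(s, t) \<in> accc C F E \<Longrightarrow> (t, s) \<in> accc C F E"
| trans: "(s, t) \<in> accc C F E \<Longrightarrow> (t, v) \<in> accc C F E \<Longrightarrow> (s, v) \<in> accc C F E"
| cong: "f \<in> F \<Longrightarrow> (s, s') \<in> accc C F E \<Longrightarrow> (t, t') \<in> accc C F E
    \<Longrightarrow> (App f s t, App f s' t') \<in> accc C F E"

abbreviation ac_equiv :: "'c set \<Rightarrow> 'f set \<Rightarrow> ('c, 'f) gterm rel" where
  "ac_equiv C F \<equiv> accc C F {}"

section \<open>Canonical rewrite systems on ground terms modulo AC\<close>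

inductive_set ctxt_step ::
    "'c set \<Rightarrow> 'f set \<Rightarrow> ('c, 'f) gterm rel \<Rightarrow> ('c, 'f) gterm rel"
  for C :: "'c set" and F :: "'f set" and R :: "('c, 'f) gterm rel" where
  root: "(l, r) \<in> R \<Longrightarrow> l \<in> gterms C F \<Longrightarrow> r \<in> gterms C F \<Longrightarrow> (l, r) \<in> ctxt_step C F R"
| left: "f \<in> F \<Longrightarrow> (s, t) \<in> ctxt_step C F R \<Longrightarrow> v \<in> gterms C F
    \<Longrightarrow> (App f s v, App f t v) \<in> ctxt_step C F R"
| right: "f \<in> F \<Longrightarrow> (s, t) \<in> ctxt_step C F R \<Longrightarrow> v \<in> gterms C F
    \<Longrightarrow> (App f v s, App f v t) \<in> ctxt_step C F R"

text \<open>Rewriting of AC classes.  On flattened terms, a rule \<open>f(A) \<rightarrow> f(B)\<close> thus rewrites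
  \<open>f(M)\<close> to \<open>f((M - A) \<union> B)\<close> whenever \<open>A \<subseteq> M\<close>, at any position.\<close>

definition ac_rewrite ::
    "'c set \<Rightarrow> 'f set \<Rightarrow> ('c, 'f) gterm rel \<Rightarrow> ('c, 'f) gterm rel" where
  "ac_rewrite C F R = ac_equiv C F O ctxt_step C F R O ac_equiv C F"

definition terminating ::
    "'c set \<Rightarrow> 'f set \<Rightarrow> ('c, 'f) gterm rel \<Rightarrow> bool" where
  "terminating C F R \<longleftrightarrow> wf ((ac_rewrite C F R)\<inverse>)"

definition confluent ::
    "'c set \<Rightarrow> 'f set \<Rightarrow> ('c, 'f) gterm rel \<Rightarrow> bool" where
  "confluent C F R \<longleftrightarrow>
    (\<forall>s\<in>gterms C F. \<forall>t t'. (s, t) \<in> (ac_rewrite C F R)\<^sup>* \<and> (s, t') \<in> (ac_rewrite C F R)\<^sup>* \<longrightarrow>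
      (\<exists>v v'. (t, v) \<in> (ac_rewrite C F R)\<^sup>* \<and> (t', v') \<in> (ac_rewrite C F R)\<^sup>* \<and>
        (v, v') \<in> ac_equiv C F))"

definition canonical :: "'c set \<Rightarrow> 'f set \<Rightarrow> ('c, 'f) gterm rel \<Rightarrow> bool" where
  "canonical C F R \<longleftrightarrow> terminating C F R \<and> confluent C F R"

definition ac_conversion ::
    "'c set \<Rightarrow> 'f set \<Rightarrow> ('c, 'f) gterm rel \<Rightarrow> ('c, 'f) gterm rel" where
  "ac_conversion C F R =
    (ac_equiv C F \<union> ac_rewrite C F R \<union> (ac_rewrite C F R)\<inverse>)\<^sup>+"

section \<open>Monomials and admissible orderings\<close>

text \<open>The monomial \<open>f(M)\<close> is represented by the multiset \<open>M\<close>; the constant \<open>c\<close> by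
  \<open>{#c#}\<close>.\<close>

type_synonym 'c mono_eqs = "('c multiset \<times> 'c multiset) set"

definition monomials :: "'c set \<Rightarrow> 'c multiset set" where
  "monomials C = {M. M \<noteq> {#} \<and> set_mset M \<subseteq> C}"

definition strict_total_on :: "'a set \<Rightarrow> ('a \<Rightarrow> 'a \<Rightarrow> bool) \<Rightarrow> bool" where
  "strict_total_on A gt \<longleftrightarrow> transp_on A gt \<and> irreflp_on A gt \<and> totalp_on A gt"

definition admissible ::
    "'c set \<Rightarrow> ('c \<Rightarrow> 'c \<Rightarrow> bool) \<Rightarrow> ('c multiset \<Rightarrow> 'c multiset \<Rightarrow> bool) \<Rightarrow> bool" where
  "admissible C gtC gt \<longleftrightarrow>
    strict_total_on (monomials C) gt \<and>
    wfp_on (monomials C) (\<lambda>B A. gt A B) \<and>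
    (\<forall>c\<in>C. \<forall>d\<in>C. gtC c d \<longrightarrow> gt {#c#} {#d#}) \<and>
    (\<forall>A\<in>monomials C. \<forall>B\<in>monomials C. B \<subset># A \<longrightarrow> gt A B) \<and>
    (\<forall>A1\<in>monomials C. \<forall>A2\<in>monomials C. \<forall>B\<in>monomials C.
      gt A1 A2 \<longrightarrow> gt (A1 + B) (A2 + B))"

definition nonconstants_greater ::
    "'c set \<Rightarrow> ('c multiset \<Rightarrow> 'c multiset \<Rightarrow> bool) \<Rightarrow> bool" where
  "nonconstants_greater C gt \<longleftrightarrow>
    (\<forall>A\<in>monomials C. \<forall>c\<in>C. size A \<ge> 2 \<longrightarrow> gt A {#c#})"

text \<open>\<open>mono_term f M t\<close>: the binary term \<open>t\<close> is one of the bracketings and orderings of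
  \<open>f(M)\<close>.\<close>

inductive mono_term :: "'f \<Rightarrow> 'c multiset \<Rightarrow> ('c, 'f) gterm \<Rightarrow> bool" for f :: 'f where
  const: "mono_term f {#c#} (Const c)"
| app: "mono_term f A s \<Longrightarrow> mono_term f B t \<Longrightarrow> mono_term f (A + B) (App f s t)"

definition term_eqs :: "'f set \<Rightarrow> 'c rel \<Rightarrow> ('f \<Rightarrow> 'c mono_eqs) \<Rightarrow> ('c, 'f) gterm rel" where
  "term_eqs F EC EF =
    {(Const c, Const d) | c d. (c, d) \<in> EC} \<union>
    {(s, t) | s t f A B. f \<in> F \<and> (A, B) \<in> EF f \<and> mono_term f A s \<and> mono_term f B t}"

section \<open>Flattening and purification\<close>

datatype ('c, 'f) fterm = FConst 'c | FApp 'f "('c, 'f) fterm multiset"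

fun flat_args :: "'f \<Rightarrow> ('c, 'f) fterm \<Rightarrow> ('c, 'f) fterm multiset" where
  "flat_args f (FConst c) = {#FConst c#}"
| "flat_args f (FApp g M) = (if g = f then M else {#FApp g M#})"

primrec flatten :: "('c, 'f) gterm \<Rightarrow> ('c, 'f) fterm" where
  "flatten (Const c) = FConst c"
| "flatten (App f s t) = FApp f (flat_args f (flatten s) + flat_args f (flatten t))"

text \<open>The flattened subterms that receive a fresh constant.  Besides the nonconstant arguments
  this includes the right side of an equation whose two sides have different outermost AC
  symbols, since such an equation is not an equation between monomials of one symbol.\<close>

inductive_set named :: "('c, 'f) gterm rel \<Rightarrow> ('c, 'f) fterm set"
  for S :: "('c, 'f) gterm rel" where
  left_arg: "(s, t) \<in> S \<Longrightarrow> flatten s = FApp f M \<Longrightarrow> FApp g N \<in># M \<Longrightarrow> FApp g N \<in> named S"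
| right_arg: "(s, t) \<in> S \<Longrightarrow> flatten t = FApp f M \<Longrightarrow> FApp g N \<in># M \<Longrightarrow> FApp g N \<in> named S"
| mixed: "(s, t) \<in> S \<Longrightarrow> flatten s = FApp f M \<Longrightarrow> flatten t = FApp g N \<Longrightarrow> f \<noteq> g
    \<Longrightarrow> FApp g N \<in> named S"
| nested: "FApp f M \<in> named S \<Longrightarrow> FApp g N \<in># M \<Longrightarrow> FApp g N \<in> named S"

text \<open>In the following, \<open>u\<close> maps each subterm to its fresh constant.\<close>

definition fresh_naming ::
    "'c set \<Rightarrow> ('c, 'f) gterm rel \<Rightarrow> (('c, 'f) fterm \<Rightarrow> 'c) \<Rightarrow> bool" where
  "fresh_naming C S u \<longleftrightarrow> inj_on u (named S) \<and> u ` named S \<inter> C = {}"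

definition ext_consts ::
    "'c set \<Rightarrow> ('c, 'f) gterm rel \<Rightarrow> (('c, 'f) fterm \<Rightarrow> 'c) \<Rightarrow> 'c set" where
  "ext_consts C S u = C \<union> u ` named S"

fun const_of :: "(('c, 'f) fterm \<Rightarrow> 'c) \<Rightarrow> ('c, 'f) fterm \<Rightarrow> 'c" where
  "const_of u (FConst c) = c"
| "const_of u (FApp f M) = u (FApp f M)"

fun mono_of :: "(('c, 'f) fterm \<Rightarrow> 'c) \<Rightarrow> 'f \<Rightarrow> ('c, 'f) fterm \<Rightarrow> 'c multiset" where
  "mono_of u f (FConst c) = {#c#}"
| "mono_of u f (FApp g M) =
    (if g = f then image_mset (const_of u) M else {#u (FApp g M)#})"

fun eq_symbol :: "('c, 'f) fterm \<Rightarrow> ('c, 'f) fterm \<Rightarrow> 'f option" where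
  "eq_symbol (FApp f M) t = Some f"
| "eq_symbol (FConst c) (FApp g N) = Some g"
| "eq_symbol (FConst c) (FConst d) = None"

definition pure_consts :: "('c, 'f) gterm rel \<Rightarrow> 'c rel" where
  "pure_consts S = {(c, d). (Const c, Const d) \<in> S}"

definition pure_monos ::
    "(('c, 'f) fterm \<Rightarrow> 'c) \<Rightarrow> ('c, 'f) gterm rel \<Rightarrow> 'f \<Rightarrow> 'c mono_eqs" where
  "pure_monos u S f =
    {(mono_of u f (flatten s), mono_of u f (flatten t)) | s t.
      (s, t) \<in> S \<and> eq_symbol (flatten s) (flatten t) = Some f} \<union>
    {(mono_of u f (FApp f M), {#u (FApp f M)#}) | M. FApp f M \<in> named S}"

section \<open>Constant rules\<close>

text \<open>The reduced canonical system of a set of constant equations: every constant is rewritten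
  to the least constant of its class.\<close>

definition const_canonical :: "('c \<Rightarrow> 'c \<Rightarrow> bool) \<Rightarrow> 'c rel \<Rightarrow> 'c rel" where
  "const_canonical gtC E =
    {(c, d). c \<noteq> d \<and> (c, d) \<in> (E \<union> E\<inverse>)\<^sup>* \<and>
      (\<forall>e. (c, e) \<in> (E \<union> E\<inverse>)\<^sup>* \<and> e \<noteq> d \<longrightarrow> gtC e d)}"

definition update_C :: "('c \<Rightarrow> 'c \<Rightarrow> bool) \<Rightarrow> 'c rel \<Rightarrow> 'c rel \<Rightarrow> 'c rel" where
  "update_C gtC RC N = const_canonical gtC (RC \<union> N)"

definition const_nf :: "'c rel \<Rightarrow> 'c \<Rightarrow> 'c" where
  "const_nf RC c = (if c \<in> Domain RC then THE d. (c, d) \<in> RC else c)"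

definition as_mono_rules :: "'c rel \<Rightarrow> 'c mono_eqs" where
  "as_mono_rules RC = {({#c#}, {#d#}) | c d. (c, d) \<in> RC}"

definition const_rules :: "'c mono_eqs \<Rightarrow> 'c rel" where
  "const_rules R = {(c, d). ({#c#}, {#d#}) \<in> R}"

section \<open>Completion for a single AC symbol\<close>

definition mono_rewrite :: "'c mono_eqs \<Rightarrow> 'c multiset rel" where
  "mono_rewrite R = {(M, (M - A) + B) | M A B. (A, B) \<in> R \<and> A \<subseteq># M}"

definition reducible :: "'c mono_eqs \<Rightarrow> 'c multiset \<Rightarrow> bool" where
  "reducible R M \<longleftrightarrow> M \<in> Domain (mono_rewrite R)"

definition joinable :: "'c mono_eqs \<Rightarrow> 'c multiset \<Rightarrow> 'c multiset \<Rightarrow> bool" where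
  "joinable R M N \<longleftrightarrow> (\<exists>K. (M, K) \<in> (mono_rewrite R)\<^sup>* \<and> (N, K) \<in> (mono_rewrite R)\<^sup>*)"

definition critical_pairs :: "'c mono_eqs \<Rightarrow> 'c mono_eqs" where
  "critical_pairs R =
    {((AB - A1) + A2, (AB - B1) + B2) | AB A1 A2 B1 B2.
      (A1, A2) \<in> R \<and> (B1, B2) \<in> R \<and> AB = (A1 + B1) - (A1 \<inter># B1)}"

text \<open>Steps on pairs of pending equations \<open>E\<close> and rules \<open>R\<close>.  \<open>K\<close> is a fixed set of constant
  rules that also takes part in rewriting and in critical pairs; it is empty in the completion of
  an input system.\<close>

inductive completion_step ::
    "('c multiset \<Rightarrow> 'c multiset \<Rightarrow> bool) \<Rightarrow> 'c mono_eqs \<Rightarrow>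
      'c mono_eqs \<times> 'c mono_eqs \<Rightarrow> 'c mono_eqs \<times> 'c mono_eqs \<Rightarrow> bool"
  for gt :: "'c multiset \<Rightarrow> 'c multiset \<Rightarrow> bool" and K :: "'c mono_eqs" where
  orient: "(s, t) \<in> E \<or> (t, s) \<in> E \<Longrightarrow> gt s t
    \<Longrightarrow> completion_step gt K (E, R) (E - {(s, t), (t, s)}, insert (s, t) R)"
| delete: "(s, s) \<in> E \<Longrightarrow> completion_step gt K (E, R) (E - {(s, s)}, R)"
| simplify_left: "(s, t) \<in> E \<Longrightarrow> (s, s') \<in> mono_rewrite (R \<union> K)
    \<Longrightarrow> completion_step gt K (E, R) (insert (s', t) (E - {(s, t)}), R)"
| simplify_right: "(s, t) \<in> E \<Longrightarrow> (t, t') \<in> mono_rewrite (R \<union> K)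
    \<Longrightarrow> completion_step gt K (E, R) (insert (s, t') (E - {(s, t)}), R)"
| deduce: "(s, t) \<in> critical_pairs (R \<union> K) \<Longrightarrow> \<not> joinable (R \<union> K) s t
    \<Longrightarrow> completion_step gt K (E, R) (insert (s, t) E, R)"
| compose: "(l, r) \<in> R \<Longrightarrow> (r, r') \<in> mono_rewrite (R \<union> K)
    \<Longrightarrow> completion_step gt K (E, R) (E, insert (l, r') (R - {(l, r)}))"
| collapse: "(l, r) \<in> R \<Longrightarrow> (l, l') \<in> mono_rewrite ((R - {(l, r)}) \<union> K)
    \<Longrightarrow> completion_step gt K (E, R) (insert (l', r) E, R - {(l, r)})"

definition reduced :: "'c mono_eqs \<Rightarrow> 'c mono_eqs \<Rightarrow> bool" where
  "reduced K R \<longleftrightarrow>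
    (\<forall>(l, r)\<in>R. \<not> reducible (R \<union> K) r \<and> \<not> reducible ((R - {(l, r)}) \<union> K) l)"

text \<open>Completion stops when there are no pending equations, no non-joinable critical pairs and
  nothing to interreduce.\<close>

definition completes_to ::
    "('c multiset \<Rightarrow> 'c multiset \<Rightarrow> bool) \<Rightarrow> 'c mono_eqs \<Rightarrow>
      'c mono_eqs \<times> 'c mono_eqs \<Rightarrow> 'c mono_eqs \<Rightarrow> bool" where
  "completes_to gt K ER R' \<longleftrightarrow>
    (completion_step gt K)\<^sup>*\<^sup>* ER ({}, R') \<and>
    (\<forall>(s, t)\<in>critical_pairs (R' \<union> K). joinable (R' \<union> K) s t) \<and>
    reduced K R'"

definition single_AC_completion ::
    "'c mono_eqs \<Rightarrow> ('c multiset \<Rightarrow> 'c multiset \<Rightarrow> bool) \<Rightarrow> 'c mono_eqs \<Rightarrow> bool" where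
  "single_AC_completion Sf gt Rf \<longleftrightarrow> completes_to gt {} (Sf, {}) Rf"

section \<open>Combination\<close>

text \<open>The constant rules \<open>RC\<close> are not copied into the updated system: \<open>Rf'\<close> is canonical together
  with \<open>RC\<close>, and its own constant rules are exactly the newly generated ones.\<close>

definition update_AC ::
    "'c mono_eqs \<Rightarrow> 'c rel \<Rightarrow> ('c multiset \<Rightarrow> 'c multiset \<Rightarrow> bool) \<Rightarrow>
      'c mono_eqs \<Rightarrow> 'c rel \<Rightarrow> bool" where
  "update_AC Rf RC gt Rf' NR \<longleftrightarrow>
    (let K = as_mono_rules RC; red = {(l, r) \<in> Rf. reducible K l}
     in completes_to gt K (red, Rf - red) Rf' \<and> NR = const_rules Rf')"

definition needs_update :: "'c rel \<Rightarrow> 'c mono_eqs \<Rightarrow> bool" where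
  "needs_update RC Rf \<longleftrightarrow> (\<exists>(l, r)\<in>Rf. reducible (as_mono_rules RC) l)"

text \<open>One execution of the body of the while loop up to the test of the collected new constant
  rules.\<close>

definition update_round ::
    "'f set \<Rightarrow> ('f \<Rightarrow> 'c multiset \<Rightarrow> 'c multiset \<Rightarrow> bool) \<Rightarrow> 'c rel \<Rightarrow>
      ('f \<Rightarrow> 'c mono_eqs) \<Rightarrow> ('f \<Rightarrow> 'c mono_eqs) \<Rightarrow> 'c rel \<Rightarrow> bool" where
  "update_round F gt RC RF RF' NNR \<longleftrightarrow>
    (\<exists>NR. (\<forall>f\<in>F. if needs_update RC (RF f)
                  then update_AC (RF f) RC (gt f) (RF' f) (NR f)
                  else RF' f = RF f \<and> NR f = {}) \<and>
          NNR = (\<Union>f\<in>F. NR f))"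

inductive update_loop ::
    "'f set \<Rightarrow> ('c \<Rightarrow> 'c \<Rightarrow> bool) \<Rightarrow> ('f \<Rightarrow> 'c multiset \<Rightarrow> 'c multiset \<Rightarrow> bool) \<Rightarrow>
      'c rel \<Rightarrow> ('f \<Rightarrow> 'c mono_eqs) \<Rightarrow> 'c rel \<Rightarrow> ('f \<Rightarrow> 'c mono_eqs) \<Rightarrow> bool"
  for F :: "'f set" and gtC :: "'c \<Rightarrow> 'c \<Rightarrow> bool"
    and gt :: "'f \<Rightarrow> 'c multiset \<Rightarrow> 'c multiset \<Rightarrow> bool" where
  stop: "update_round F gt RC RF RF' {} \<Longrightarrow> update_loop F gtC gt RC RF RC RF'"
| continue: "update_round F gt RC RF RF' NNR \<Longrightarrow> NNR \<noteq> {}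
    \<Longrightarrow> update_loop F gtC gt (update_C gtC RC NNR) RF' RC'' RF''
    \<Longrightarrow> update_loop F gtC gt RC RF RC'' RF''"

text \<open>\<open>combination_mult_AC F gtC gt SC SF RC RF\<close>: some run on the purified input \<open>SC\<close>, \<open>SF\<close>
  ends with the constant rules \<open>RC\<close> and the rules \<open>RF f\<close> for each \<open>f\<close>.\<close>

definition combination_mult_AC ::
    "'f set \<Rightarrow> ('c \<Rightarrow> 'c \<Rightarrow> bool) \<Rightarrow> ('f \<Rightarrow> 'c multiset \<Rightarrow> 'c multiset \<Rightarrow> bool) \<Rightarrow>
      'c rel \<Rightarrow> ('f \<Rightarrow> 'c mono_eqs) \<Rightarrow> 'c rel \<Rightarrow> ('f \<Rightarrow> 'c mono_eqs) \<Rightarrow> bool" where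
  "combination_mult_AC F gtC gt SC SF RC RF \<longleftrightarrow>
    (\<exists>RC0 RF0 RC1.
      RC0 = const_canonical gtC SC \<and>
      (\<forall>f\<in>F. single_AC_completion
        (map_prod (image_mset (const_nf RC0)) (image_mset (const_nf RC0)) ` SF f)
        (gt f) (RF0 f)) \<and>
      RC1 = update_C gtC RC0 (\<Union>f\<in>F. const_rules (RF0 f)) \<and>
      (if RC1 \<noteq> RC0 then update_loop F gtC gt RC1 RF0 RC RF else RC = RC0 \<and> RF = RF0))"

end

theory Submission
  imports Defs
begin

text \<open>Two ground terms are AC-equal iff their flattenings agree, so everything can be read off layers
  of constants under one AC symbol.

  Every inference of the completion and of the combination loop preserves the set of AC congruences
  satisfying the current equations, which gives the equality of the closures. On exit no \<open>RF f\<close>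
  contains a constant rule and each \<open>RF f \<union> RC\<close> has only joinable critical pairs: for an updated symbol
  by construction, for an untouched one because \<open>RC\<close> cannot rewrite its left sides, so that the
  earlier joining sequences survive normalization of the constants.

  The union terminates because rules over constants never create a layer: a step removes a layer or
  decreases the constants of one layer in the order of its symbol. For confluence, terms are normalized
  bottom-up, layer by layer, with the unique monomial normal forms. Since a constant has the same
  normal form in all systems, the result is invariant under the whole congruence.

  The restriction to the original signature holds because replacing each fresh constant by the subterm
  it names maps every purified equation to a consequence of \<open>S\<close>.\<close>

section \<open>Ground terms modulo AC\<close>

text \<open>There is no common ordering on terms. The orderings \<open>gt f\<close> agree on
  constants only, and when an \<open>f\<close>-argument of a \<open>g\<close>-layer collapses to a
  constant, that layer grows in \<open>gt g\<close>. The number of layers therefore has to come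
  first in the termination measure, which works only if no left side in \<open>RF f\<close> is a
  constant. Here the hypothesis that nonconstant monomials exceed constants enters, together with
  the exit test of the loop, which leaves constant rules in \<open>RC\<close> alone. Local peaks of
  terms are never analysed: Newman's lemma is applied to monomials of one symbol, and a normal form
  function carries the result to terms.

  Completion is a nondeterministic relation that also discards equations, so closures of
  intermediate systems are not compared. A run is observed by an arbitrary set \<open>E\<close> of
  term equations, asking whether ACCC(E) satisfies the current system. Taking for \<open>E\<close>
  the equations at either end of the run yields the two inclusions.\<close>

lemma accc_gterms:
  "(s, t) \<in> accc C F E \<Longrightarrow> s \<in> gterms C F \<and> t \<in> gterms C F"
  by (induction rule: accc.induct) (auto intro: gterms.intros)

lemma accc_least:
  assumes "\<And>s t. (s, t) \<in> E \<Longrightarrow> s \<in> gterms C F \<Longrightarrow> t \<in> gterms C F \<Longrightarrow> (s, t) \<in> accc C F E'"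
  shows "accc C F E \<subseteq> accc C F E'"
proof safe
  fix s t assume "(s, t) \<in> accc C F E"
  then show "(s, t) \<in> accc C F E'"
    by (induction rule: accc.induct) (auto intro: accc.intros assms)
qed

lemma gterms_AppD: "App f s t \<in> gterms C F \<Longrightarrow> f \<in> F \<and> s \<in> gterms C F \<and> t \<in> gterms C F"
  by (auto elim: gterms.cases)

lemma gterms_ConstD: "Const c \<in> gterms C F \<Longrightarrow> c \<in> C"
  by (auto elim: gterms.cases)

lemma gterms_mono: "s \<in> gterms C F \<Longrightarrow> C \<subseteq> D \<Longrightarrow> s \<in> gterms D F"
  by (induction rule: gterms.induct) (auto intro: gterms.intros)

section \<open>Binary trees over one AC symbol and their rearrangement\<close>

inductive tree :: "'f \<Rightarrow> ('c, 'f) gterm multiset \<Rightarrow> ('c, 'f) gterm \<Rightarrow> bool" for f :: 'f where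
  leaf: "tree f {#t#} t"
| node: "tree f A s \<Longrightarrow> tree f B t \<Longrightarrow> tree f (A + B) (App f s t)"

lemma tree_nonempty: "tree f A t \<Longrightarrow> A \<noteq> {#}"
  by (induction rule: tree.induct) auto

lemma tree_singleton: "tree f {#x#} t \<Longrightarrow> t = x"
  by (erule tree.cases) (auto simp: single_is_union dest: tree_nonempty)

lemma tree_gterms:
  "tree f A t \<Longrightarrow> f \<in> F \<Longrightarrow> set_mset A \<subseteq> gterms C F \<Longrightarrow> t \<in> gterms C F"
  by (induction rule: tree.induct) (auto intro: gterms.intros)

lemma tree_exists: "A \<noteq> {#} \<Longrightarrow> \<exists>t. tree f A t"
proof (induction A)
  case (add x A)
  then show ?case
    by (cases "A = {#}") (use tree.intros[of f] in \<open>metis add_mset_add_single union_commute\<close>)+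
qed simp

text \<open>Associativity brings a leaf of the left subtree to the front; one use of commutativity
  reduces the right subtree to that case. The leaf must not be the only one, since there is no unit
  to stand for an empty rest.\<close>

lemma tree_extract:
  assumes "tree f A s" "x \<in># A" "A \<noteq> {#x#}" "f \<in> F" "set_mset A \<subseteq> gterms C F"
  shows "\<exists>s'. tree f (A - {#x#}) s' \<and> (s, App f x s') \<in> accc C F E"
  using assms
proof (induction rule: tree.induct)
  case (leaf t)
  then show ?case by simp
next
  case (node A s B t)
  have gA: "s \<in> gterms C F" and gB: "t \<in> gterms C F"
    using node tree_gterms by (metis le_sup_iff set_mset_union)+
  have gx: "x \<in> gterms C F" using node by auto
  show ?case
  proof (cases "x \<in># A")
    case True
    show ?thesis
    proof (cases "A = {#x#}")
      case True
      then have "s = x" using node(1) tree_singleton by metis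
      then show ?thesis using True node gx gB by (auto intro: accc.refl gterms.app)
    next
      case False
      then obtain s' where s': "tree f (A - {#x#}) s'" "(s, App f x s') \<in> accc C F E"
        using node True by auto
      then have gs': "s' \<in> gterms C F" using accc_gterms gterms_AppD by metis
      have "tree f (A - {#x#} + B) (App f s' t)" using s' node by (auto intro: tree.node)
      moreover have "A - {#x#} + B = A + B - {#x#}" using True by simp
      moreover have "(App f s t, App f (App f x s') t) \<in> accc C F E"
        using s' gB node by (auto intro: accc.cong accc.refl)
      then have "(App f s t, App f x (App f s' t)) \<in> accc C F E"
        using accc.assoc[of f F x C s' t E] gx gs' gB node accc.sym accc.trans by metis
      ultimately show ?thesis by metis
    qed
  next
    case False
    then have xB: "x \<in># B" using node by auto
    have c: "(App f s t, App f t s) \<in> accc C F E" using gA gB node by (auto intro: accc.comm)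
    show ?thesis
    proof (cases "B = {#x#}")
      case True
      then have "t = x" using node(2) tree_singleton by metis
      then show ?thesis using True node c by auto
    next
      case False
      then obtain s' where s': "tree f (B - {#x#}) s'" "(t, App f x s') \<in> accc C F E"
        using node xB by auto
      then have gs': "s' \<in> gterms C F" using accc_gterms gterms_AppD by metis
      have "tree f (B - {#x#} + A) (App f s' s)" using s' node by (auto intro: tree.node)
      moreover have "B - {#x#} + A = A + B - {#x#}" using xB by (simp add: union_commute)
      moreover have "(App f t s, App f (App f x s') s) \<in> accc C F E"
        using s' gA node by (auto intro: accc.cong accc.refl)
      then have "(App f s t, App f x (App f s' s)) \<in> accc C F E"
        using accc.assoc[of f F x C s' s E] gx gs' gA node c accc.sym accc.trans by metis
      ultimately show ?thesis by metis
    qed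
  qed
qed

text \<open>Leaves are matched through keys so that one lemma serves several comparisons: by
  flattening, by identity, and, with different keys on the two sides, of subterms with the constants
  naming them. The induction removes one pair of leaves with equal keys by
  \<open>tree_extract\<close> on both sides.\<close>

lemma tree_equiv:
  assumes "tree f A s" "tree f B t" "f \<in> F"
    and "set_mset A \<subseteq> gterms C F" "set_mset B \<subseteq> gterms C F"
    and "image_mset \<phi> A = image_mset \<psi> B"
    and "\<And>x y. x \<in># A \<Longrightarrow> y \<in># B \<Longrightarrow> \<phi> x = \<psi> y \<Longrightarrow> (x, y) \<in> accc C F E"
  shows "(s, t) \<in> accc C F E"
  using assms
proof (induction "size A" arbitrary: A B s t)
  case 0
  then show ?case using tree_nonempty by fastforce
next
  case (Suc n)
  obtain x A' where A: "A = add_mset x A'" using Suc(2,3) by (metis size_eq_Suc_imp_eq_union)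
  then have "\<phi> x \<in># image_mset \<psi> B" using Suc(8) by (metis msed_map_invL union_single_eq_member)
  then obtain y where y: "y \<in># B" "\<phi> x = \<psi> y" by auto
  then obtain B' where B: "B = add_mset y B'" by (metis insert_DiffM)
  have xy: "(x, y) \<in> accc C F E" using Suc(9) A B y by auto
  have im: "image_mset \<phi> A' = image_mset \<psi> B'" using Suc(8) A B y by auto
  show ?case
  proof (cases "A' = {#}")
    case True
    then have "B' = {#}" using im by simp
    then have "s = x" "t = y" using Suc True A B tree_singleton by metis+
    then show ?thesis using xy by simp
  next
    case False
    then have "B' \<noteq> {#}" using im by auto
    then obtain t' where t': "tree f B' t'" "(t, App f y t') \<in> accc C F E"
      using tree_extract[OF Suc(4), of y F C E] Suc B by auto
    obtain s' where s': "tree f A' s'" "(s, App f x s') \<in> accc C F E"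
      using tree_extract[OF Suc(3), of x F C E] Suc A False by auto
    have "(s', t') \<in> accc C F E"
      using Suc(1)[of A' s' B' t'] Suc(2-) A B s'(1) t'(1) im by auto
    then have "(App f x s', App f y t') \<in> accc C F E" using xy Suc by (auto intro: accc.cong)
    then show ?thesis using s' t' accc.trans accc.sym by metis
  qed
qed

section \<open>Maximal arguments and flattening\<close>

primrec gargs :: "'f \<Rightarrow> ('c, 'f) gterm \<Rightarrow> ('c, 'f) gterm multiset" where
  "gargs f (Const c) = {#Const c#}"
| "gargs f (App g s t) = (if g = f then gargs f s + gargs f t else {#App g s t#})"

lemma tree_gargs: "tree f (gargs f t) t"
  by (induction t) (auto intro: tree.intros)

lemma gargs_gterms: "t \<in> gterms C F \<Longrightarrow> set_mset (gargs f t) \<subseteq> gterms C F"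
  by (induction rule: gterms.induct) (auto intro: gterms.intros)

lemma gargs_size: "x \<in># gargs f t \<Longrightarrow> size x \<le> size t"
  by (induction t) (auto split: if_splits)

lemma gargs_not_App: "x \<in># gargs f t \<Longrightarrow> x \<noteq> App f a b"
  by (induction t) (auto split: if_splits)

text \<open>Ties flattening to the finest tree of a term, whose leaves are not headed by
  \<open>f\<close>. Multisets of flat arguments can thereby be pulled back to multisets of
  subterms.\<close>

lemma flat_args_flatten: "flat_args f (flatten t) = image_mset flatten (gargs f t)"
  by (induction t) auto

lemma flatten_eq_FConst: "flatten t = FConst c \<longleftrightarrow> t = Const c"
  by (cases t) auto

lemma flatten_eq_FApp: "flatten t = FApp f M \<Longrightarrow> \<exists>a b. t = App f a b"
  by (cases t) auto

text \<open>Equal flattenings have the same head \<open>f\<close> and equal multisets of flattened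
  arguments, so \<open>tree_equiv\<close> applies with \<open>flatten\<close> as key. The maximal
  arguments of \<open>App f s1 s2\<close> lie inside \<open>s1\<close> or \<open>s2\<close>, which
  makes the induction on size work.\<close>

lemma flatten_eq_accc:
  "flatten s = flatten t \<Longrightarrow> s \<in> gterms C F \<Longrightarrow> t \<in> gterms C F \<Longrightarrow> (s, t) \<in> accc C F E"
proof (induction "size s" arbitrary: s t rule: less_induct)
  case less
  show ?case
  proof (cases s)
    case (Const c)
    then show ?thesis using less flatten_eq_FConst by (metis accc.refl flatten.simps(1))
  next
    case (App f s1 s2)
    then obtain t1 t2 where t: "t = App f t1 t2"
      using less(2) flatten_eq_FApp by (metis flatten.simps(2))
    have f: "f \<in> F" using less App gterms_AppD by metis
    have small: "size x < size s" if "x \<in># gargs f s" for x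
      using that App gargs_size[of x f s1] gargs_size[of x f s2] by auto
    show ?thesis
    proof (rule tree_equiv[OF tree_gargs tree_gargs f, where \<phi> = flatten and \<psi> = flatten])
      show "set_mset (gargs f s) \<subseteq> gterms C F" "set_mset (gargs f t) \<subseteq> gterms C F"
        by (rule gargs_gterms[OF less.prems(2)], rule gargs_gterms[OF less.prems(3)])
      then show "(x, y) \<in> accc C F E"
        if "x \<in># gargs f s" "y \<in># gargs f t" "flatten x = flatten y" for x y
        using less.hyps[OF small[OF that(1)] that(3)] that by blast
      show "image_mset flatten (gargs f s) = image_mset flatten (gargs f t)"
        using less.prems(1) by (metis flat_args_flatten)
    qed
  qed
qed

text \<open>Makes the rearrangement lemmas available for monomials. In the converse, the multiset of
  constants is split along each node of the tree.\<close>

lemma mono_term_iff_tree: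
  fixes t :: "('c, 'f) gterm"
  shows "mono_term f A t \<longleftrightarrow> tree f (image_mset Const A) t"
proof
  show "mono_term f A t \<Longrightarrow> tree f (image_mset Const A) t"
    by (induction rule: mono_term.induct) (auto intro: tree.intros)
  show "tree f (image_mset Const A) t \<Longrightarrow> mono_term f A t"
  proof (induction "image_mset Const A :: ('c, 'f) gterm multiset" t arbitrary: A rule: tree.induct)
    case (leaf t)
    then have "size A = 1" by (metis size_image_mset size_single)
    then obtain c where "A = {#c#}" by (metis One_nat_def size_1_singleton_mset)
    then show ?case using leaf by (auto intro: mono_term.intros)
  next
    case (node X s Y t)
    then obtain A1 A2 where "A = A1 + A2" "X = image_mset Const A1" "Y = image_mset Const A2"
      by (metis image_mset_eq_plusD)
    then show ?case using node by (auto intro: mono_term.intros)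
  qed
qed

lemma mono_term_singleton: "mono_term f {#c#} t \<longleftrightarrow> t = Const c"
  using tree_singleton[of f "Const c" t] by (auto simp: mono_term_iff_tree intro: tree.leaf)

lemma mono_term_exists: "A \<noteq> {#} \<Longrightarrow> \<exists>t. mono_term f A t"
  using tree_exists[of "image_mset Const A" f] by (simp add: mono_term_iff_tree)

lemma mono_term_gterms:
  "mono_term f A t \<Longrightarrow> f \<in> F \<Longrightarrow> set_mset A \<subseteq> C \<Longrightarrow> t \<in> gterms C F"
  by (induction rule: mono_term.induct) (auto intro: gterms.intros)

lemma mono_term_accc:
  assumes "mono_term f A s" "mono_term f A t" "f \<in> F" "set_mset A \<subseteq> C"
  shows "(s, t) \<in> accc C F E"
  using assms(1,2) unfolding mono_term_iff_tree
  by (rule tree_equiv[where \<phi> = id and \<psi> = id])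
    (use assms(3,4) in \<open>auto intro!: gterms.const accc.refl\<close>)

lemma tree_flat_args: "tree f X t \<Longrightarrow> flat_args f (flatten t) = (\<Sum>x\<in>#X. flat_args f (flatten x))"
  by (induction rule: tree.induct) auto

section \<open>Conversion\<close>

lemma accc_mono: "E \<subseteq> E' \<Longrightarrow> accc C F E \<subseteq> accc C F E'"
  by (rule accc_least) (auto intro: accc.eqn)

lemma ctxt_step_accc: "(s, t) \<in> ctxt_step C F R \<Longrightarrow> (s, t) \<in> accc C F R"
  by (induction rule: ctxt_step.induct) (auto intro: accc.eqn accc.cong accc.refl)

lemma ac_rewrite_accc: "(s, t) \<in> ac_rewrite C F R \<Longrightarrow> (s, t) \<in> accc C F R"
  unfolding ac_rewrite_def using accc_mono[of "{}" R C F] ctxt_step_accc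
  by (blast intro: accc.trans[OF accc.trans])

lemma ac_rewrite_gterms:
  "(s, t) \<in> ac_rewrite C F R \<Longrightarrow> s \<in> gterms C F \<and> t \<in> gterms C F"
  using ac_rewrite_accc accc_gterms by metis

lemma ctxt_step_rewrite: "(s, t) \<in> ctxt_step C F R \<Longrightarrow> (s, t) \<in> ac_rewrite C F R"
  unfolding ac_rewrite_def using ctxt_step_accc[of s t C F R] accc_gterms[of s t C F R]
  by (auto intro!: relcompI accc.refl)

lemma ac_rewrite_left:
  assumes "(s, t) \<in> ac_rewrite C F R" "f \<in> F" "v \<in> gterms C F"
  shows "(App f s v, App f t v) \<in> ac_rewrite C F R"
proof -
  obtain s' t' where "(s, s') \<in> ac_equiv C F" "(s', t') \<in> ctxt_step C F R" "(t', t) \<in> ac_equiv C F"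
    using assms unfolding ac_rewrite_def by auto
  then show ?thesis unfolding ac_rewrite_def using assms
    by (auto intro!: relcompI accc.cong accc.refl ctxt_step.left)
qed

lemma ac_rewrite_right:
  assumes "(s, t) \<in> ac_rewrite C F R" "f \<in> F" "v \<in> gterms C F"
  shows "(App f v s, App f v t) \<in> ac_rewrite C F R"
proof -
  obtain s' t' where "(s, s') \<in> ac_equiv C F" "(s', t') \<in> ctxt_step C F R" "(t', t) \<in> ac_equiv C F"
    using assms unfolding ac_rewrite_def by auto
  then show ?thesis unfolding ac_rewrite_def using assms
    by (auto intro!: relcompI accc.cong accc.refl ctxt_step.right)
qed

text \<open>The direction from the closure needs conversion to be compatible with
  \<open>App\<close>. Steps act in one argument at a time, so a congruence step is composed of a
  left part and a right part.\<close>

lemma ac_conversion_eq_accc: "ac_conversion C F R = accc C F R"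
proof (intro equalityI subrelI)
  fix s t assume "(s, t) \<in> ac_conversion C F R"
  then show "(s, t) \<in> accc C F R" unfolding ac_conversion_def
  proof (induction rule: trancl_induct)
    case (base y)
    then show ?case using accc_mono[of "{}" R C F] ac_rewrite_accc accc.sym by blast
  next
    case (step y z)
    then have "(y, z) \<in> accc C F R"
      using accc_mono[of "{}" R C F] ac_rewrite_accc accc.sym by blast
    then show ?case using step accc.trans by metis
  qed
next
  let ?S = "ac_equiv C F \<union> ac_rewrite C F R \<union> (ac_rewrite C F R)\<inverse>"
  have symS: "sym ?S" by (auto intro!: symI intro: accc.sym)
  have L: "(App f s v, App f t v) \<in> ?S\<^sup>+" if "(s, t) \<in> ?S\<^sup>+" "f \<in> F" "v \<in> gterms C F" for f s t v
    using that(1)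
  proof (induction rule: trancl_induct)
    case (base y)
    then have "(App f s v, App f y v) \<in> ?S"
      using that ac_rewrite_left[of _ _ C F R f v] by (auto intro: accc.cong accc.refl)
    then show ?case by (rule r_into_trancl)
  next
    case (step y z)
    then have "(App f y v, App f z v) \<in> ?S"
      using that ac_rewrite_left[of _ _ C F R f v] by (auto intro: accc.cong accc.refl)
    then show ?case by (rule trancl_into_trancl[OF step.IH])
  qed
  have R: "(App f v s, App f v t) \<in> ?S\<^sup>+" if "(s, t) \<in> ?S\<^sup>+" "f \<in> F" "v \<in> gterms C F" for f s t v
    using that(1)
  proof (induction rule: trancl_induct)
    case (base y)
    then have "(App f v s, App f v y) \<in> ?S"
      using that ac_rewrite_right[of _ _ C F R f v] by (auto intro: accc.cong accc.refl)
    then show ?case by (rule r_into_trancl)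
  next
    case (step y z)
    then have "(App f v y, App f v z) \<in> ?S"
      using that ac_rewrite_right[of _ _ C F R f v] by (auto intro: accc.cong accc.refl)
    then show ?case by (rule trancl_into_trancl[OF step.IH])
  qed
  fix s t assume "(s, t) \<in> accc C F R"
  then have "(s, t) \<in> ?S\<^sup>+"
  proof (induction rule: accc.induct)
    case (eqn s t)
    then show ?case by (auto intro!: r_into_trancl ctxt_step_rewrite ctxt_step.root)
  next
    case (sym s t)
    then show ?case using sym_trancl[OF symS] by (simp only: sym_def)
  next
    case (trans s t v)
    from trans.IH show ?case by (rule trancl_trans)
  next
    case (cong f s s' t t')
    then have "(App f s t, App f s' t) \<in> ?S\<^sup>+" "(App f s' t, App f s' t') \<in> ?S\<^sup>+"
      using L[of s s' f t] R[of t t' f s'] accc_gterms[of s s' C F R] accc_gterms[of t t' C F R]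
      by blast+
    then show ?case by (rule trancl_trans)
  qed (blast intro: accc.intros)+
  then show "(s, t) \<in> ac_conversion C F R" by (simp add: ac_conversion_def)
qed

section \<open>Termination and confluence of a combined system\<close>

text \<open>Argued along the transitive closure inside \<open>mult\<close>, so \<open>r\<close> need
  not be transitive; below it is built from single rewrite steps.\<close>

lemma mult_union: "(A, B) \<in> mult r \<Longrightarrow> (A + Z, B + Z) \<in> mult r"
  unfolding mult_def
proof (induction rule: trancl_induct)
  case (base y)
  then show ?case using mult1_union[of A y r Z] by (auto simp: union_commute)
next
  case (step y z)
  then show ?case using mult1_union[of y z r Z] by (auto simp: union_commute)
qed

text \<open>An explicit context \<open>Z\<close> replaces the truncated difference by sums, so that
  closure under larger contexts is mere associativity.\<close>

lemma mono_rewrite_iff: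
  "(M, N) \<in> mono_rewrite R \<longleftrightarrow> (\<exists>A B Z. (A, B) \<in> R \<and> M = A + Z \<and> N = B + Z)"
proof
  assume "(M, N) \<in> mono_rewrite R"
  then obtain A B where "(A, B) \<in> R" "A \<subseteq># M" "N = (M - A) + B"
    unfolding mono_rewrite_def by auto
  then show "\<exists>A B Z. (A, B) \<in> R \<and> M = A + Z \<and> N = B + Z"
    by (metis subset_mset.add_diff_inverse union_commute)
next
  assume "\<exists>A B Z. (A, B) \<in> R \<and> M = A + Z \<and> N = B + Z"
  then obtain A B Z where AB: "(A, B) \<in> R" "M = A + Z" "N = B + Z" by blast
  then have "A \<subseteq># M" "N = (M - A) + B" by (auto simp: union_commute)
  then show "(M, N) \<in> mono_rewrite R" unfolding mono_rewrite_def using AB(1) by blast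
qed

lemma mono_rewrite_add: "(M, N) \<in> mono_rewrite R \<Longrightarrow> (M + Z, N + Z) \<in> mono_rewrite R"
  unfolding mono_rewrite_iff by (metis union_assoc)

lemma mono_rewrites_add: "(M, N) \<in> (mono_rewrite R)\<^sup>* \<Longrightarrow> (M + Z, N + Z) \<in> (mono_rewrite R)\<^sup>*"
  by (induction rule: rtrancl_induct) (auto intro: rtrancl_into_rtrancl mono_rewrite_add)

lemma mono_rewrite_rule: "(A, B) \<in> R \<Longrightarrow> (A, B) \<in> mono_rewrite R"
  unfolding mono_rewrite_def by force

text \<open>The constants of the topmost \<open>f\<close>-layer of a term (empty if its outermost symbol is another
  one), and the layers strictly below that layer, each as its symbol with its constants.\<close>

primrec top_consts :: "'f \<Rightarrow> ('c, 'f) gterm \<Rightarrow> 'c multiset" where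
  "top_consts f (Const c) = {#c#}"
| "top_consts f (App g s t) = (if f = g then top_consts f s + top_consts f t else {#})"

primrec layers :: "'f \<Rightarrow> ('c, 'f) gterm \<Rightarrow> ('f \<times> 'c multiset) multiset" where
  "layers f (Const c) = {#}"
| "layers f (App g s t) = layers g s + layers g t +
    (if f = g then {#} else {#(g, top_consts g s + top_consts g t)#})"

text \<open>Bracketing and argument order are invisible to both functions, so a measure built from
  them depends on the AC class alone.\<close>

lemma ac_equiv_layers:
  "(s, t) \<in> ac_equiv C F \<Longrightarrow> top_consts f s = top_consts f t \<and> layers f s = layers f t"
  by (induction s t arbitrary: f rule: accc.induct) (auto simp: ac_simps)

lemma top_consts_gterms: "t \<in> gterms C F \<Longrightarrow> set_mset (top_consts f t) \<subseteq> C"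
  by (induction rule: gterms.induct) auto

lemma mono_term_layers: "mono_term f A t \<Longrightarrow> top_consts f t = A \<and> layers f t = {#}"
  by (induction rule: mono_term.induct) auto

lemma mono_term_flat_args: "mono_term f A t \<Longrightarrow> flat_args f (flatten t) = image_mset FConst A"
  by (induction rule: mono_term.induct) auto

section \<open>Flat layers: constants and aliens\<close>

primrec const_part :: "('c, 'f) fterm \<Rightarrow> 'c multiset" where
  "const_part (FConst c) = {#c#}"
| "const_part (FApp f M) = {#}"

definition consts_of :: "('c, 'f) fterm multiset \<Rightarrow> 'c multiset" where
  "consts_of X = (\<Sum>x\<in>#X. const_part x)"

text \<open>Aliens are the nonconstant arguments, recognised by their empty constant part. Monomial
  rules act on the constants of a layer and pass the aliens by.\<close>

definition aliens_of :: "('c, 'f) fterm multiset \<Rightarrow> ('c, 'f) fterm multiset" where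
  "aliens_of X = filter_mset (\<lambda>x. const_part x = {#}) X"

lemma consts_aliens_union [simp]:
  "consts_of (X + Y) = consts_of X + consts_of Y"
  "aliens_of (X + Y) = aliens_of X + aliens_of Y"
  "consts_of (image_mset FConst A) = A" "aliens_of (image_mset FConst A) = {#}"
  "consts_of (aliens_of X) = {#}" "aliens_of (aliens_of X) = aliens_of X"
  by (auto simp: consts_of_def aliens_of_def sum_mset.neutral image_mset.compositionality comp_def
      filter_mset_image_mset filter_filter_mset)

lemma consts_aliens_partition: "X = image_mset FConst (consts_of X) + aliens_of X"
proof (induction X)
  case (add x X)
  then show ?case by (cases x) (auto simp: consts_of_def aliens_of_def)
qed (auto simp: consts_of_def aliens_of_def)

lemma set_consts_of: "set_mset (consts_of X) = {c. FConst c \<in># X}"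
proof (induction X)
  case (add x X)
  then show ?case by (cases x) (auto simp: consts_of_def)
qed (auto simp: consts_of_def)

text \<open>A single argument stands for itself, because a binary symbol applied to one argument is
  no term. This is how a layer that shrinks to one constant becomes that constant.\<close>

definition pack :: "'f \<Rightarrow> ('c, 'f) fterm multiset \<Rightarrow> ('c, 'f) fterm" where
  "pack f Y = (if size Y = 1 then THE x. Y = {#x#} else FApp f Y)"

lemma pack_singleton [simp]: "pack f {#x#} = x"
  by (simp add: pack_def)

lemma flat_args_nonempty: "flat_args f (flatten t) \<noteq> {#}"
  using tree_nonempty[OF tree_gargs] by (simp add: flat_args_flatten)

text \<open>Valid for every \<open>f\<close>: a term with another head is its own single argument.
  Flattenings can thus be compared on \<open>f\<close>-arguments without a case distinction on
  heads.\<close>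

lemma flatten_pack: "flatten t = pack f (flat_args f (flatten t))"
proof (cases "\<exists>a b. t = App f a b")
  case True
  then obtain a b where t: "t = App f a b" by blast
  have "size (flat_args f (flatten a)) \<ge> 1" "size (flat_args f (flatten b)) \<ge> 1"
    using flat_args_nonempty by (metis One_nat_def Suc_leI nonempty_has_size)+
  then show ?thesis using t by (auto simp: pack_def)
next
  case False
  then have "flat_args f (flatten t) = {#flatten t#}"
    by (cases t) auto
  then show ?thesis by simp
qed

text \<open>Properly flattened terms over \<open>D\<close>: no \<open>f\<close> occurs directly
  below \<open>f\<close>. For argument multisets of this kind \<open>flat_args f\<close> undoes
  \<open>pack f\<close>.\<close>

inductive good :: "'c set \<Rightarrow> ('c, 'f) fterm \<Rightarrow> bool" for D :: "'c set" where
  "c \<in> D \<Longrightarrow> good D (FConst c)"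
| "(\<And>x. x \<in># X \<Longrightarrow> good D x) \<Longrightarrow> (\<And>N. FApp f N \<notin># X) \<Longrightarrow> good D (FApp f X)"

lemma good_FConst [simp]: "good D (FConst c) \<longleftrightarrow> c \<in> D"
  by (auto intro: good.intros elim: good.cases)

lemma good_FApp: "good D (FApp f X) \<longleftrightarrow> (\<forall>x\<in>#X. good D x) \<and> (\<forall>N. FApp f N \<notin># X)"
  by (auto intro: good.intros elim: good.cases)

lemma good_flat_args:
  "good D x \<Longrightarrow> y \<in># flat_args f x \<Longrightarrow> good D y \<and> y \<noteq> FApp f N"
  by (cases x) (auto simp: good_FApp split: if_splits)

lemma good_pack:
  assumes "\<And>x. x \<in># X \<Longrightarrow> good D x" "\<And>N. FApp f N \<notin># X"
  shows "good D (pack f X)" "flat_args f (pack f X) = X"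
proof -
  have "good D (pack f X) \<and> flat_args f (pack f X) = X"
  proof (cases "size X = 1")
    case True
    then obtain x where "X = {#x#}" by (metis One_nat_def size_1_singleton_mset)
    then show ?thesis using assms by (cases x) auto
  next
    case False
    then show ?thesis using assms by (auto simp: pack_def good_FApp)
  qed
  then show "good D (pack f X)" "flat_args f (pack f X) = X" by auto
qed

text \<open>What the term level requires from the monomial level. \<open>T f\<close> collects the
  rules acting on an \<open>f\<close>-layer; for \<open>f\<close> outside \<open>F\<close> only
  constant rules remain, since the measure is taken relative to arbitrary symbols.
  \<open>norm f\<close> must be reachable and invariant under steps. The glue between the symbols is
  \<open>norm_const\<close>: all of them send a constant to the same
  \<open>\<kappa> c\<close>.\<close>

locale combined =
  fixes D :: "'c set" and F :: "'f set" and RC :: "'c rel" and RF :: "'f \<Rightarrow> 'c mono_eqs"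
    and \<kappa> :: "'c \<Rightarrow> 'c" and norm :: "'f \<Rightarrow> 'c multiset \<Rightarrow> 'c multiset"
    and T :: "'f \<Rightarrow> 'c mono_eqs" and less :: "'f \<Rightarrow> 'c multiset rel"
  defines "T f \<equiv> (if f \<in> F then RF f else {}) \<union> as_mono_rules RC"
    and "less f \<equiv> {(N, M). (M, N) \<in> mono_rewrite (T f) \<and> set_mset M \<subseteq> D}"
  assumes RC_carrier: "RC \<subseteq> D \<times> D"
    and RF_carrier: "f \<in> F \<Longrightarrow> RF f \<subseteq> monomials D \<times> monomials D"
    and RF_nonconst: "f \<in> F \<Longrightarrow> (A, B) \<in> RF f \<Longrightarrow> size A \<ge> 2"
    and wf_less: "wf (less f)"
    and norm_steps: "f \<in> F \<Longrightarrow> set_mset M \<subseteq> D \<Longrightarrow> (M, norm f M) \<in> (mono_rewrite (T f))\<^sup>*"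
    and norm_step: "f \<in> F \<Longrightarrow> set_mset M \<subseteq> D \<Longrightarrow> (M, N) \<in> mono_rewrite (T f) \<Longrightarrow>
      norm f M = norm f N"
    and norm_const: "f \<in> F \<Longrightarrow> c \<in> D \<Longrightarrow> norm f {#c#} = {#\<kappa> c#}"
    and \<kappa>: "c \<in> D \<Longrightarrow> \<kappa> c = c \<or> (c, \<kappa> c) \<in> RC"
    and \<kappa>_step: "(c, d) \<in> RC \<Longrightarrow> \<kappa> c = \<kappa> d"
begin

abbreviation RS :: "('c, 'f) gterm rel" where
  "RS \<equiv> term_eqs F RC RF"

lemma T_carrier: "f \<in> F \<Longrightarrow> T f \<subseteq> monomials D \<times> monomials D"
  using RF_carrier[of f] RC_carrier unfolding T_def as_mono_rules_def monomials_def by auto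

section \<open>Termination: counting and comparing layers\<close>

lemma less_add: "(N, M) \<in> less f \<Longrightarrow> set_mset Z \<subseteq> D \<Longrightarrow> (N + Z, M + Z) \<in> less f"
  unfolding less_def by (auto intro: mono_rewrite_add)

text \<open>Layers are comparable only if they carry the same symbol, and then by the rewrite steps
  of that symbol; the orderings of different symbols never meet.\<close>

definition layer_less :: "('f \<times> 'c multiset) rel" where
  "layer_less = same_fst (\<lambda>_. True) less"

text \<open>The decrease as seen from a surrounding \<open>f\<close>. If a layer disappears, the top
  layer may change freely, because a collapse adds a constant to it. With the number of layers
  unchanged, only one of the two parts may change; the required equality of the other part is what
  makes the relation stable under contexts.\<close>

definition smaller :: "'f \<Rightarrow> ('c, 'f) gterm \<Rightarrow> ('c, 'f) gterm \<Rightarrow> bool" where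
  "smaller f t s \<longleftrightarrow> size (layers f t) < size (layers f s) \<or>
    size (layers f t) = size (layers f s) \<and>
     (top_consts f t = top_consts f s \<and> (layers f t, layers f s) \<in> mult layer_less \<or>
      layers f t = layers f s \<and> (top_consts f t, top_consts f s) \<in> less f)"

lemma layer_less_mult: "(N, M) \<in> less f \<Longrightarrow> (add_mset (f, N) X, add_mset (f, M) X) \<in> mult layer_less"
  using one_step_implies_mult[of "{#(f, M)#}" "{#(f, N)#}" layer_less X]
  by (simp add: layer_less_def same_fst_def)

text \<open>If \<open>f = g\<close>, the top layer of the argument merges into the one of the whole
  term. Otherwise the \<open>g\<close>-layer is now complete and counts among the lower layers, so
  that a decrease of its constants turns into a multiset decrease of layers.\<close>

lemma smaller_App:
  assumes "smaller g t s" "v \<in> gterms D F"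
  shows "smaller f (App g t v) (App g s v)"
proof (cases "f = g")
  case True
  then show ?thesis using assms(1) mult_union[of "layers g t" "layers g s" layer_less "layers g v"]
      less_add[of "top_consts g t" "top_consts g s" g "top_consts g v"]
      top_consts_gterms[OF assms(2)] unfolding smaller_def by auto
next
  case False
  have "(add_mset (g, top_consts g s + top_consts g v) (layers g t + layers g v),
      add_mset (g, top_consts g s + top_consts g v) (layers g s + layers g v)) \<in> mult layer_less"
    if "(layers g t, layers g s) \<in> mult layer_less"
    using mult_union[OF that, of "add_mset (g, top_consts g s + top_consts g v) (layers g v)"] by simp
  then show ?thesis using False assms(1) layer_less_mult[OF less_add,
      of "top_consts g t" "top_consts g s" g "top_consts g v"]
      top_consts_gterms[OF assms(2)] unfolding smaller_def by auto
qed

lemma smaller_App_right: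
  assumes "smaller g t s" "v \<in> gterms D F"
  shows "smaller f (App g v t) (App g v s)"
  using smaller_App[OF assms, of f] unfolding smaller_def by (auto simp: union_commute)

text \<open>Seen from a symbol other than \<open>f\<close>, the left side is one whole
  \<open>f\<close>-layer because it is not a constant. The right side is a constant, and the layer
  is gone, or a smaller \<open>f\<close>-layer. A constant left side would allow a rule to create a
  layer.\<close>

lemma smaller_rule:
  assumes "(l, r) \<in> RS" "l \<in> gterms D F"
  shows "smaller h r l"
proof -
  consider (const) c d where "(c, d) \<in> RC" "l = Const c" "r = Const d"
    | (mono) f A B where "f \<in> F" "(A, B) \<in> RF f" "mono_term f A l" "mono_term f B r"
    using assms unfolding term_eqs_def by blast
  then show ?thesis
  proof cases
    case const
    then have "({#c#}, {#d#}) \<in> T h" by (auto simp: T_def as_mono_rules_def)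
    then show ?thesis using const RC_carrier mono_rewrite_rule
      by (auto simp: smaller_def less_def)
  next
    case mono
    note l = mono_term_layers[OF mono(3)] and r = mono_term_layers[OF mono(4)]
    have AB: "(B, A) \<in> less f" using mono RF_carrier[of f]
      by (auto simp: less_def T_def monomials_def intro!: mono_rewrite_rule)
    show ?thesis
    proof (cases "h = f")
      case True
      then show ?thesis using l r AB by (auto simp: smaller_def)
    next
      case False
      obtain a b where lab: "l = App f a b"
        using mono(3) RF_nonconst[OF mono(1,2)] by (cases rule: mono_term.cases) auto
      show ?thesis using mono(4)
      proof (cases rule: mono_term.cases)
        case (const c)
        then show ?thesis using lab False by (auto simp: smaller_def)
      next
        case (app X s Y t)
        then show ?thesis using lab False l r layer_less_mult[OF AB, of "{#}"]
          by (auto simp: smaller_def)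
      qed
    qed
  qed
qed

lemma smaller_ctxt_step:
  "(s, t) \<in> ctxt_step D F RS \<Longrightarrow> smaller h t s"
  by (induction arbitrary: h rule: ctxt_step.induct)
    (auto intro: smaller_rule smaller_App smaller_App_right)

theorem terminating: "terminating D F RS"
proof -
  fix h :: 'f
  \<comment> \<open>The top layer, possibly empty, joins the layers below it, so that both
    equal-size alternatives of \<open>smaller h\<close> become one decrease in
    \<open>mult layer_less\<close>.\<close>
  let ?m = "\<lambda>t. add_mset (h, top_consts h t) (layers h t)"
  let ?W = "inv_image (less_than <*lex*> mult layer_less) (\<lambda>t. (size (?m t), ?m t))"
  have "wf layer_less" unfolding layer_less_def by (rule wf_same_fst) (rule wf_less)
  then have "wf ?W" by (intro wf_inv_image wf_lex_prod wf_less_than wf_mult)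
  moreover have "(ac_rewrite D F RS)\<inverse> \<subseteq> ?W"
  proof safe
    fix s t assume "(t, s) \<in> ac_rewrite D F RS"
    then obtain t' s' where st: "(t, t') \<in> ac_equiv D F" "(t', s') \<in> ctxt_step D F RS"
        "(s', s) \<in> ac_equiv D F"
      unfolding ac_rewrite_def by auto
    have eq: "?m t = ?m t'" "?m s = ?m s'"
      using ac_equiv_layers[OF st(1), of h] ac_equiv_layers[OF st(3), of h] by auto
    have "(s', t') \<in> ?W"
      using smaller_ctxt_step[OF st(2), of h] layer_less_mult[of _ _ h "layers h t'"]
        mult_union[of "layers h s'" "layers h t'" layer_less "{#(h, top_consts h t')#}"]
      unfolding smaller_def by auto
    then show "(s, t) \<in> ?W" using eq by (simp only: in_inv_image)
  qed
  ultimately show ?thesis unfolding terminating_def by (rule wf_subset)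
qed

section \<open>Normal forms of terms modulo AC\<close>

lemma T_empty: "f \<in> F \<Longrightarrow> (A, B) \<in> T f \<Longrightarrow> A \<noteq> {#} \<and> B \<noteq> {#} \<and> set_mset A \<subseteq> D \<and> set_mset B \<subseteq> D"
  using T_carrier[of f] by (auto simp: monomials_def)

lemma step_carrier:
  assumes "f \<in> F" "(M, N) \<in> mono_rewrite (T f)" "set_mset M \<subseteq> D"
  shows "set_mset N \<subseteq> D"
proof -
  obtain A B Z where AB: "(A, B) \<in> T f" "M = A + Z" "N = B + Z"
    using assms(2) unfolding mono_rewrite_iff by blast
  then show ?thesis using T_empty[OF assms(1) AB(1)] assms(3) by simp
qed

lemma steps_norm:
  assumes "(M, N) \<in> (mono_rewrite (T f))\<^sup>*" "f \<in> F" "set_mset M \<subseteq> D"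
  shows "norm f M = norm f N \<and> set_mset N \<subseteq> D"
  using assms
proof (induction rule: rtrancl_induct)
  case (step y z)
  then show ?case using norm_step[of f y z] step_carrier[of f y z] by auto
qed simp

lemma norm_carrier: "f \<in> F \<Longrightarrow> set_mset M \<subseteq> D \<Longrightarrow> set_mset (norm f M) \<subseteq> D"
  using steps_norm norm_steps by blast

text \<open>Normalizing part of a layer early does not affect the normal form of the whole layer.
  This is what associativity demands of a bottom-up computation.\<close>

lemma norm_norm_add:
  assumes "f \<in> F" "set_mset M \<subseteq> D" "set_mset Z \<subseteq> D"
  shows "norm f (norm f M + Z) = norm f (M + Z)"
  using steps_norm[OF mono_rewrites_add[OF norm_steps]] assms by (metis Un_subset_iff set_mset_union)

definition norm_args :: "'f \<Rightarrow> ('c, 'f) fterm multiset \<Rightarrow> ('c, 'f) fterm multiset" where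
  "norm_args f X = image_mset FConst (norm f (consts_of X)) + aliens_of X"

lemma norm_args_norm_args_add:
  assumes "f \<in> F" "set_mset (consts_of X) \<subseteq> D" "set_mset (consts_of Z) \<subseteq> D"
  shows "norm_args f (norm_args f X + Z) = norm_args f (X + Z)"
  using norm_norm_add[OF assms] by (simp add: norm_args_def)

text \<open>Only the constants of the merged layer are normalized at a node; its aliens are already
  in normal form. Since \<open>pack\<close> returns a collapsed layer as a bare constant, the
  enclosing layer can use it in its own rules.\<close>

primrec nf :: "('c, 'f) gterm \<Rightarrow> ('c, 'f) fterm" where
  "nf (Const c) = FConst (\<kappa> c)"
| "nf (App f s t) = pack f (norm_args f (flat_args f (nf s) + flat_args f (nf t)))"

lemma norm_args_good:
  assumes "f \<in> F" "\<And>x N. x \<in># X \<Longrightarrow> good D x \<and> x \<noteq> FApp f N"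
  shows "x \<in># norm_args f X \<Longrightarrow> good D x \<and> x \<noteq> FApp f N"
proof -
  have "set_mset (consts_of X) \<subseteq> D" using assms(2) by (force simp: set_consts_of)
  then have "set_mset (norm f (consts_of X)) \<subseteq> D" using assms norm_carrier by blast
  then show "x \<in># norm_args f X \<Longrightarrow> good D x \<and> x \<noteq> FApp f N"
    using assms(2) by (auto simp: norm_args_def aliens_of_def)
qed

lemma \<kappa>_carrier: "c \<in> D \<Longrightarrow> \<kappa> c \<in> D"
  using \<kappa>[of c] RC_carrier by auto

lemma nf_good: "t \<in> gterms D F \<Longrightarrow> good D (nf t)"
proof (induction rule: gterms.induct)
  case (app f s t)
  have X: "good D x \<and> x \<noteq> FApp f N" if "x \<in># flat_args f (nf s) + flat_args f (nf t)" for x N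
    using that good_flat_args[OF app.IH(1)] good_flat_args[OF app.IH(2)] by fastforce
  note Y = norm_args_good[where X = "flat_args f (nf s) + flat_args f (nf t)", OF app(1) X]
  show ?case unfolding nf.simps by (intro good_pack) (use Y in blast)+
qed (auto intro: \<kappa>_carrier)

lemma flat_args_nf_App:
  assumes "f \<in> F" "s \<in> gterms D F" "t \<in> gterms D F"
  shows "flat_args f (nf (App f s t)) = norm_args f (flat_args f (nf s) + flat_args f (nf t))"
proof -
  have X: "good D x \<and> x \<noteq> FApp f N" if "x \<in># flat_args f (nf s) + flat_args f (nf t)" for x N
    using that good_flat_args[OF nf_good[OF assms(2)]] good_flat_args[OF nf_good[OF assms(3)]]
    by fastforce
  note Y = norm_args_good[where X = "flat_args f (nf s) + flat_args f (nf t)", OF assms(1) X]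
  show ?thesis unfolding nf.simps by (intro good_pack) (use Y in blast)+
qed

lemma consts_flat_args_nf: "t \<in> gterms D F \<Longrightarrow> set_mset (consts_of (flat_args f (nf t))) \<subseteq> D"
  using good_flat_args[OF nf_good] by (force simp: set_consts_of)

text \<open>The leaves are normalized by \<open>\<kappa>\<close> before the layer is assembled;
  \<open>norm_const\<close> covers this at the leaves and \<open>norm_norm_add\<close> at the
  nodes.\<close>

lemma mono_term_nf:
  assumes "mono_term f A t" "f \<in> F" "set_mset A \<subseteq> D"
  shows "flat_args f (nf t) = image_mset FConst (norm f A) \<and> nf t = pack f (flat_args f (nf t))"
  using assms
proof (induction rule: mono_term.induct)
  case (const c)
  then show ?case by (simp add: norm_const)
next
  case (app A s B t)
  then have "flat_args f (nf (App f s t)) = norm_args f (flat_args f (nf s) + flat_args f (nf t))"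
    by (intro flat_args_nf_App) (auto intro: mono_term_gterms)
  moreover have "norm f (norm f A + norm f B) = norm f (A + B)"
    using app norm_norm_add[of f A "norm f B"] norm_norm_add[of f B A] norm_carrier[of f B]
    by (simp add: union_commute)
  ultimately show ?case using app by (simp add: norm_args_def)
qed

text \<open>Invariance under rules comes from the monomial level, commutativity and congruence hold
  by the shape of \<open>nf\<close>, and for associativity both bracketings normalize the same union
  of three argument multisets.\<close>

lemma nf_accc: "(s, t) \<in> accc D F RS \<Longrightarrow> nf s = nf t"
proof (induction rule: accc.induct)
  case (eqn s t)
  then consider (const) c d where "(c, d) \<in> RC" "s = Const c" "t = Const d"
    | (mono) f A B where "f \<in> F" "(A, B) \<in> RF f" "mono_term f A s" "mono_term f B t"
    unfolding term_eqs_def by blast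
  then show ?case
  proof cases
    case const
    then show ?thesis using \<kappa>_step by simp
  next
    case mono
    then have AB: "(A, B) \<in> T f" by (simp add: T_def)
    then have "norm f A = norm f B"
      using norm_step[OF mono(1) _ mono_rewrite_rule] T_empty[OF mono(1) AB] by blast
    then show ?thesis using mono_term_nf[OF mono(3,1)] mono_term_nf[OF mono(4,1)]
        T_empty[OF mono(1) AB] by metis
  qed
next
  case (assoc f s t v)
  note g = consts_flat_args_nf[OF assoc(2)] consts_flat_args_nf[OF assoc(3)]
    consts_flat_args_nf[OF assoc(4)]
  let ?s = "flat_args f (nf s)" and ?t = "flat_args f (nf t)" and ?v = "flat_args f (nf v)"
  have "norm_args f (norm_args f (?t + ?v) + ?s) = norm_args f (?t + ?v + ?s)"
    using assoc g by (intro norm_args_norm_args_add) auto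
  moreover have "norm_args f (norm_args f (?s + ?t) + ?v) = norm_args f (?s + ?t + ?v)"
    using assoc g by (intro norm_args_norm_args_add) auto
  ultimately have "norm_args f (?s + norm_args f (?t + ?v)) = norm_args f (norm_args f (?s + ?t) + ?v)"
    by (simp add: ac_simps)
  then show ?case using assoc nf.simps(2)[of f s "App f t v"] nf.simps(2)[of f "App f s t" v]
    by (simp only: flat_args_nf_App)
qed (auto simp: union_commute)

text \<open>Modulo AC the left side can be gathered into one subterm \<open>l\<close>, with all
  other arguments collected in a second subterm \<open>v\<close>; the rule then applies at
  \<open>l\<close>. The multiset \<open>Y\<close> is carried along unchanged.\<close>

lemma lift_mono_rewrite:
  assumes "f \<in> F" "w \<in> gterms D F"
    and "flat_args f (flatten w) = image_mset FConst A + Y"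
    and "(A, A') \<in> mono_rewrite (T f)"
  shows "\<exists>w'. (w, w') \<in> ac_rewrite D F RS \<and> flat_args f (flatten w') = image_mset FConst A' + Y"
proof -
  obtain A1 A2 where A12: "(A1, A2) \<in> T f" "A1 \<subseteq># A" "A' = A - A1 + A2"
    using assms(4) unfolding mono_rewrite_def by auto
  define Z where "Z = A - A1"
  have AZ: "A = A1 + Z" "A' = A2 + Z"
    using A12 by (simp_all add: Z_def union_commute del: subset_mset.add_diff_assoc2)
  obtain X B where XB: "gargs f w = X + B" "image_mset flatten X = image_mset FConst A"
      "image_mset flatten B = Y"
    using assms(3) image_mset_eq_plusD unfolding flat_args_flatten by metis
  note A12' = T_empty[OF assms(1) A12(1)]
  obtain l r where l: "mono_term f A1 l" and r: "mono_term f A2 r"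
    using A12' mono_term_exists by metis
  have gl: "l \<in> gterms D F" and gr: "r \<in> gterms D F"
    using l r A12' assms(1) mono_term_gterms by metis+
  have lr: "(l, r) \<in> ctxt_step D F RS"
  proof (rule ctxt_step.root[OF _ gl gr])
    show "(l, r) \<in> RS" using A12(1) l r assms(1)
      by (auto simp: T_def term_eqs_def as_mono_rules_def mono_term_singleton)
  qed
  have fl: "flat_args f (flatten l) = image_mset FConst A1"
    and fr: "flat_args f (flatten r) = image_mset FConst A2"
    by (rule mono_term_flat_args[OF l], rule mono_term_flat_args[OF r])
  \<comment> \<open>The arguments that the rule does not consume: the leftover constants and the
    preimages of \<open>Y\<close>.\<close>
  define W where "W = image_mset Const Z + B"
  have Bargs: "flat_args f (flatten b) = {#flatten b#}" if "b \<in># B" for b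
    using gargs_not_App[of b f w] that XB(1) by (cases b) auto
  have gW: "set_mset W \<subseteq> gterms D F"
  proof -
    have "FConst c \<in># flat_args f (flatten w)" if "c \<in># Z" for c
      using assms(3) AZ that by auto
    then have "Const c \<in># gargs f w" if "c \<in># Z" for c
      using that unfolding flat_args_flatten by (auto simp: image_iff) (metis flatten_eq_FConst)
    moreover have "b \<in># gargs f w" if "b \<in># B" for b using that XB by auto
    ultimately show ?thesis using gargs_gterms[OF assms(2), of f] by (auto simp: W_def)
  qed
  have fW: "(\<Sum>x\<in>#W. flat_args f (flatten x)) = image_mset FConst Z + Y"
  proof -
    have "(\<Sum>x\<in>#B. flat_args f (flatten x)) = (\<Sum>x\<in>#B. {#flatten x#})"
      using Bargs by (intro arg_cong[where f = sum_mset] image_mset_cong) auto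
    then show ?thesis using XB(3) by (auto simp: W_def image_mset.compositionality comp_def)
  qed
  \<comment> \<open>Without leftover arguments there is no term \<open>v\<close>, and the rule
    rewrites the whole class of \<open>w\<close> at the root.\<close>
  show ?thesis
  proof (cases "W = {#}")
    case True
    then have "Z = {#}" "B = {#}" by (auto simp: W_def)
    then have "flat_args f (flatten w) = flat_args f (flatten l)"
      using assms(3) AZ fl XB by auto
    then have "flatten w = flatten l" using flatten_pack by metis
    then have "(w, l) \<in> ac_equiv D F" using gl assms(2) flatten_eq_accc by metis
    then have "(w, r) \<in> ac_rewrite D F RS" using lr gr accc.refl unfolding ac_rewrite_def by blast
    then show ?thesis using fr AZ \<open>Z = {#}\<close> \<open>B = {#}\<close> XB by auto
  next
    case False
    then obtain v where v: "tree f W v" using tree_exists by metis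
    then have gv: "v \<in> gterms D F" using tree_gterms gW assms(1) by metis
    have fv: "flat_args f (flatten v) = image_mset FConst Z + Y"
      using tree_flat_args[OF v] fW by simp
    have "flat_args f (flatten w) = flat_args f (flatten (App f l v))"
      using assms(3) AZ fl fv by (simp add: ac_simps)
    then have "flatten w = flatten (App f l v)" using flatten_pack by metis
    then have "(w, App f l v) \<in> ac_equiv D F"
      using gl gv assms flatten_eq_accc gterms.app by metis
    moreover have "(App f l v, App f r v) \<in> ctxt_step D F RS"
      using lr gv assms(1) by (auto intro: ctxt_step.left)
    moreover have "(App f r v, App f r v) \<in> ac_equiv D F"
      using gr gv assms(1) by (auto intro: accc.refl gterms.app)
    ultimately have "(w, App f r v) \<in> ac_rewrite D F RS" unfolding ac_rewrite_def by blast
    moreover have "flat_args f (flatten (App f r v)) = image_mset FConst A' + Y"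
      using AZ fr fv by (simp add: ac_simps)
    ultimately show ?thesis by blast
  qed
qed

lemma lift_mono_rewrites:
  assumes "(A, A') \<in> (mono_rewrite (T f))\<^sup>*" "f \<in> F" "w \<in> gterms D F"
    and "flat_args f (flatten w) = image_mset FConst A + Y"
  shows "\<exists>w'. (w, w') \<in> (ac_rewrite D F RS)\<^sup>* \<and> w' \<in> gterms D F \<and>
    flat_args f (flatten w') = image_mset FConst A' + Y"
  using assms(1)
proof (induction rule: rtrancl_induct)
  case base
  then show ?case using assms by blast
next
  case (step y z)
  then obtain w' where w': "(w, w') \<in> (ac_rewrite D F RS)\<^sup>*" "w' \<in> gterms D F"
      "flat_args f (flatten w') = image_mset FConst y + Y" by blast
  obtain w'' where "(w', w'') \<in> ac_rewrite D F RS" "flat_args f (flatten w'') = image_mset FConst z + Y"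
    using lift_mono_rewrite[OF assms(2) w'(2,3) step(2)] by blast
  then show ?case using w'(1) ac_rewrite_gterms by (meson rtrancl.rtrancl_into_rtrancl)
qed

lemma ac_rewrites_App:
  assumes "(s, s') \<in> (ac_rewrite D F R)\<^sup>*" "(t, t') \<in> (ac_rewrite D F R)\<^sup>*" "f \<in> F"
    "s' \<in> gterms D F" "t \<in> gterms D F"
  shows "(App f s t, App f s' t') \<in> (ac_rewrite D F R)\<^sup>*"
proof -
  have "(App f s t, App f s' t) \<in> (ac_rewrite D F R)\<^sup>*" using assms(1)
    by (induction rule: rtrancl_induct)
      (auto intro: rtrancl_into_rtrancl ac_rewrite_left[OF _ assms(3,5)])
  also have "(App f s' t, App f s' t') \<in> (ac_rewrite D F R)\<^sup>*" using assms(2)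
    by (induction rule: rtrancl_induct)
      (auto intro: rtrancl_into_rtrancl ac_rewrite_right[OF _ assms(3,4)])
  finally show ?thesis .
qed

text \<open>\<open>nf s\<close> is a flat term, so what is reached is a binary term flattening to
  it. At a node the children are rewritten first, and the rewriting of the merged constants is then
  lifted with the aliens as untouched rest.\<close>

lemma rewrites_to_nf:
  "s \<in> gterms D F \<Longrightarrow> \<exists>v. (s, v) \<in> (ac_rewrite D F RS)\<^sup>* \<and> v \<in> gterms D F \<and> flatten v = nf s"
proof (induction rule: gterms.induct)
  case (const c)
  have "(Const c, Const (\<kappa> c)) \<in> (ac_rewrite D F RS)\<^sup>*"
  proof (cases "\<kappa> c = c")
    case False
    then have "(c, \<kappa> c) \<in> RC" using const \<kappa> by blast
    then have "(Const c, Const (\<kappa> c)) \<in> RS" by (auto simp: term_eqs_def)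
    then show ?thesis using const \<kappa>_carrier
      by (auto intro!: r_into_rtrancl ctxt_step_rewrite ctxt_step.root gterms.const)
  qed simp
  then show ?case using const \<kappa>_carrier
    by (auto intro!: exI[of _ "Const (\<kappa> c)"] gterms.const)
next
  case (app f s t)
  then obtain s' t' where s': "(s, s') \<in> (ac_rewrite D F RS)\<^sup>*" "s' \<in> gterms D F" "flatten s' = nf s"
    and t': "(t, t') \<in> (ac_rewrite D F RS)\<^sup>*" "t' \<in> gterms D F" "flatten t' = nf t" by blast
  let ?X = "flat_args f (nf s) + flat_args f (nf t)"
  have "set_mset (consts_of ?X) \<subseteq> D" using consts_flat_args_nf app by simp
  then have steps: "(consts_of ?X, norm f (consts_of ?X)) \<in> (mono_rewrite (T f))\<^sup>*"
    using norm_steps app by blast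
  have "flat_args f (flatten (App f s' t')) = ?X" using s' t' by simp
  then have "flat_args f (flatten (App f s' t')) = image_mset FConst (consts_of ?X) + aliens_of ?X"
    using consts_aliens_partition by metis
  then obtain w where w: "(App f s' t', w) \<in> (ac_rewrite D F RS)\<^sup>*" "w \<in> gterms D F"
      "flat_args f (flatten w) = norm_args f ?X"
    using lift_mono_rewrites[OF steps app(1) gterms.app[OF app(1) s'(2) t'(2)]]
    unfolding norm_args_def by blast
  have "flatten w = nf (App f s t)" using flatten_pack[of w f] w(3) by simp
  moreover have "(App f s t, w) \<in> (ac_rewrite D F RS)\<^sup>*"
    using ac_rewrites_App[OF s'(1) t'(1) app(1) s'(2) app(3)] w(1) by (rule rtrancl_trans)
  ultimately show ?case using w(2) by blast
qed

lemma nf_rewrites: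
  "(s, t) \<in> (ac_rewrite D F RS)\<^sup>* \<Longrightarrow> s \<in> gterms D F \<Longrightarrow> t \<in> gterms D F \<and> nf s = nf t"
  by (induction rule: rtrancl_induct) (auto dest: nf_accc[OF ac_rewrite_accc] ac_rewrite_gterms)

theorem confluent: "confluent D F RS"
  unfolding confluent_def
proof (intro ballI allI impI)
  fix s t t' assume s: "s \<in> gterms D F"
    and st: "(s, t) \<in> (ac_rewrite D F RS)\<^sup>* \<and> (s, t') \<in> (ac_rewrite D F RS)\<^sup>*"
  then have t: "t \<in> gterms D F" "t' \<in> gterms D F" "nf t = nf t'" using nf_rewrites by metis+
  then obtain v v' where "(t, v) \<in> (ac_rewrite D F RS)\<^sup>*" "(t', v') \<in> (ac_rewrite D F RS)\<^sup>*"
      "v \<in> gterms D F" "v' \<in> gterms D F" "flatten v = flatten v'"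
    using rewrites_to_nf by metis
  then show "\<exists>v v'. (t, v) \<in> (ac_rewrite D F RS)\<^sup>* \<and> (t', v') \<in> (ac_rewrite D F RS)\<^sup>* \<and>
      (v, v') \<in> ac_equiv D F"
    using flatten_eq_accc by metis
qed

end

section \<open>Completion of monomial equations\<close>

lemma mono_rewrite_mono: "R \<subseteq> R' \<Longrightarrow> mono_rewrite R \<subseteq> mono_rewrite R'"
  unfolding mono_rewrite_def by blast

lemma joinable_add: "joinable R M N \<Longrightarrow> joinable R (M + Z) (N + Z)"
  unfolding joinable_def using mono_rewrites_add by blast

lemma critical_overlap:
  "A1 + B1 - A1 \<inter># B1 = A1 + (B1 - A1)" "A1 + B1 - A1 \<inter># B1 = B1 + (A1 - B1)"
  by (auto simp: multiset_eq_iff min_def)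

lemma critical_pair_peak:
  assumes "(s, t) \<in> critical_pairs R"
  obtains A1 A2 B1 B2 M where "(A1, A2) \<in> R" "(B1, B2) \<in> R" "M = A1 + (B1 - A1)"
    "(M, s) \<in> mono_rewrite {(A1, A2)}" "(M, t) \<in> mono_rewrite {(B1, B2)}"
proof -
  obtain A1 A2 B1 B2 where r: "(A1, A2) \<in> R" "(B1, B2) \<in> R"
    "s = (A1 + B1 - A1 \<inter># B1 - A1) + A2" "t = (A1 + B1 - A1 \<inter># B1 - B1) + B2"
    using assms unfolding critical_pairs_def by blast
  have "(A1 + (B1 - A1), s) \<in> mono_rewrite {(A1, A2)}"
    using r(3) unfolding critical_overlap(1) mono_rewrite_def by auto
  moreover have "(B1 + (A1 - B1), t) \<in> mono_rewrite {(B1, B2)}"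
    using r(4) unfolding critical_overlap(2) mono_rewrite_def by auto
  ultimately show thesis using that r(1,2) critical_overlap by metis
qed

text \<open>Both left sides fit into \<open>M\<close> exactly if their multiset union does, so every
  peak is a critical pair in a context. Critical pairs are formed for all pairs of rules, hence
  disjoint redexes need no separate treatment.\<close>

lemma peak_joinable:
  assumes "\<forall>(s, t)\<in>critical_pairs R. joinable R s t"
    and "(M, N1) \<in> mono_rewrite R" "(M, N2) \<in> mono_rewrite R"
  shows "joinable R N1 N2"
proof -
  obtain A1 A2 B1 B2 where r: "(A1, A2) \<in> R" "A1 \<subseteq># M" "N1 = (M - A1) + A2"
      "(B1, B2) \<in> R" "B1 \<subseteq># M" "N2 = (M - B1) + B2"
    using assms(2,3) unfolding mono_rewrite_def by blast
  define AB where "AB = A1 + B1 - A1 \<inter># B1"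
  have cp: "(AB - A1 + A2, AB - B1 + B2) \<in> critical_pairs R"
    unfolding critical_pairs_def AB_def using r by blast
  have sup: "AB = A1 \<union># B1" by (auto simp: AB_def multiset_eq_iff)
  then have "AB \<subseteq># M" using r by simp
  then obtain Z where Z: "M = AB + Z" unfolding mset_subset_eq_exists_conv by blast
  have diff: "M - X + Y = (AB - X + Y) + Z" if X: "X \<subseteq># AB" for X Y
  proof -
    obtain W where W: "AB = X + W" using X unfolding mset_subset_eq_exists_conv by blast
    then have "M - X = W + Z" unfolding Z by (simp add: union_assoc)
    then show ?thesis unfolding W by (simp add: ac_simps)
  qed
  have "N1 = (AB - A1 + A2) + Z" "N2 = (AB - B1 + B2) + Z"
    unfolding r(3,6) by (rule diff, simp add: sup)+
  then show ?thesis using assms(1) cp joinable_add by (metis (no_types, lifting) case_prodD)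
qed

text \<open>Reflexivity is restricted to nonempty monomials because the intended instances are
  relations between terms, and no term represents the empty multiset.\<close>

definition mono_congruence :: "'c set \<Rightarrow> 'c multiset rel \<Rightarrow> bool" where
  "mono_congruence D H \<longleftrightarrow> (\<forall>A\<in>monomials D. (A, A) \<in> H) \<and> sym H \<and> trans H \<and>
    (\<forall>A B Z. (A, B) \<in> H \<longrightarrow> set_mset Z \<subseteq> D \<longrightarrow> (A + Z, B + Z) \<in> H)"

lemma mono_congruence_rewrite:
  assumes "mono_congruence D H" "R \<subseteq> H" "(M, N) \<in> mono_rewrite R" "set_mset M \<subseteq> D"
  shows "(M, N) \<in> H" "(N, M) \<in> H"
proof -
  obtain A B Z where "(A, B) \<in> R" "M = A + Z" "N = B + Z"
    using assms(3) unfolding mono_rewrite_iff by blast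
  then show "(M, N) \<in> H" using assms unfolding mono_congruence_def by auto
  then show "(N, M) \<in> H" using assms unfolding mono_congruence_def sym_def by blast
qed

lemma mono_rewrite_monomials:
  assumes "R \<subseteq> monomials D \<times> monomials D" "(M, N) \<in> mono_rewrite R" "set_mset M \<subseteq> D"
  shows "M \<in> monomials D \<and> N \<in> monomials D"
proof -
  obtain A B Z where "(A, B) \<in> R" "M = A + Z" "N = B + Z"
    using assms(2) unfolding mono_rewrite_iff by blast
  then show ?thesis using assms unfolding monomials_def by auto
qed

lemma critical_pair_monomials:
  assumes "R \<subseteq> monomials D \<times> monomials D" "(s, t) \<in> critical_pairs R"
  obtains M where "M \<in> monomials D" "(M, s) \<in> mono_rewrite R" "(M, t) \<in> mono_rewrite R"
    "s \<in> monomials D" "t \<in> monomials D"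
proof -
  obtain A1 A2 B1 B2 M where p: "(A1, A2) \<in> R" "(B1, B2) \<in> R" "M = A1 + (B1 - A1)"
    "(M, s) \<in> mono_rewrite {(A1, A2)}" "(M, t) \<in> mono_rewrite {(B1, B2)}"
    using critical_pair_peak[OF assms(2)] by metis
  have "set_mset A1 \<subseteq> D" "set_mset B1 \<subseteq> D" using p(1,2) assms(1) by (auto simp: monomials_def)
  then have "set_mset M \<subseteq> D" using p(3) by (auto dest: in_diffD)
  moreover have "(M, s) \<in> mono_rewrite R" "(M, t) \<in> mono_rewrite R"
    using p mono_rewrite_mono[of "{(A1, A2)}" R] mono_rewrite_mono[of "{(B1, B2)}" R] by auto
  ultimately show thesis using that mono_rewrite_monomials[OF assms(1)] by blast
qed

section \<open>Invariants of completion\<close>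

lemma completion_step_monomials:
  assumes "completion_step gt K (E, R) (E', R')"
    and "E \<subseteq> monomials D \<times> monomials D" "R \<subseteq> monomials D \<times> monomials D"
    and "K \<subseteq> monomials D \<times> monomials D"
  shows "E' \<subseteq> monomials D \<times> monomials D \<and> R' \<subseteq> monomials D \<times> monomials D"
proof -
  have rw: "N \<in> monomials D"
    if "(M, N) \<in> mono_rewrite Q" "M \<in> monomials D" "Q \<subseteq> R \<union> K" for M N Q
  proof -
    have "(M, N) \<in> mono_rewrite (R \<union> K)" using that mono_rewrite_mono by blast
    then show ?thesis using mono_rewrite_monomials[of "R \<union> K" D M N] that assms
      by (auto simp: monomials_def)
  qed
  from assms(1) show ?thesis
  proof (cases rule: completion_step.cases)
    case (deduce s t)
    then show ?thesis using critical_pair_monomials[of "R \<union> K" D s t] assms by auto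
  next
    case (collapse l r l')
    then have "l' \<in> monomials D" using rw[of l l' "R - {(l, r)} \<union> K"] assms by auto
    then show ?thesis using collapse assms by auto
  next
    case (orient s t)
    then show ?thesis using assms by auto
  next
    case (delete s)
    then show ?thesis using assms by auto
  next
    case (simplify_left s t s')
    then show ?thesis using rw[of s s' "R \<union> K"] assms by auto
  next
    case (simplify_right s t t')
    then show ?thesis using rw[of t t' "R \<union> K"] assms by auto
  next
    case (compose l r r')
    then show ?thesis using rw[of r r' "R \<union> K"] assms by auto
  qed
qed

text \<open>Completion introduces no constants. As \<open>D\<close> is arbitrary and no ordering is
  involved, this also applies to the subset of constants that the initial constant rules leave
  fixed.\<close>

lemma completion_steps_monomials:
  assumes "(completion_step gt K)\<^sup>*\<^sup>* (E, R) (E', R')"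
    and "E \<subseteq> monomials D \<times> monomials D" "R \<subseteq> monomials D \<times> monomials D"
    and "K \<subseteq> monomials D \<times> monomials D"
  shows "E' \<subseteq> monomials D \<times> monomials D \<and> R' \<subseteq> monomials D \<times> monomials D"
  using assms(1)
proof (induction rule: rtranclp_induct2)
  case refl
  then show ?case using assms by blast
next
  case (step E1 R1 E2 R2)
  then show ?case using completion_step_monomials assms(4) by blast
qed

definition oriented ::
    "'c set \<Rightarrow> ('c multiset \<Rightarrow> 'c multiset \<Rightarrow> bool) \<Rightarrow> 'c mono_eqs \<Rightarrow> bool" where
  "oriented D gt R \<longleftrightarrow> R \<subseteq> monomials D \<times> monomials D \<and> (\<forall>(l, r)\<in>R. gt l r)"

lemma admissible_irrefl: "admissible D gtC gt \<Longrightarrow> A \<in> monomials D \<Longrightarrow> \<not> gt A A"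
  unfolding admissible_def strict_total_on_def irreflp_on_def by blast

lemma admissible_trans:
  "admissible D gtC gt \<Longrightarrow> A \<in> monomials D \<Longrightarrow> B \<in> monomials D \<Longrightarrow> Z \<in> monomials D \<Longrightarrow>
    gt A B \<Longrightarrow> gt B Z \<Longrightarrow> gt A Z"
  unfolding admissible_def strict_total_on_def transp_on_def by blast

lemma oriented_rewrite:
  assumes "admissible D gtC gt" "oriented D gt R" "(M, N) \<in> mono_rewrite R" "set_mset M \<subseteq> D"
  shows "M \<in> monomials D" "N \<in> monomials D" "gt M N"
proof -
  obtain A B Z where r: "(A, B) \<in> R" "M = A + Z" "N = B + Z"
    using assms(3) unfolding mono_rewrite_iff by blast
  show "M \<in> monomials D" "N \<in> monomials D"
    using mono_rewrite_monomials[OF _ assms(3,4)] assms(2) by (auto simp: oriented_def)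
  have AB: "A \<in> monomials D" "B \<in> monomials D" "gt A B"
    using r assms(2) unfolding oriented_def by auto
  \<comment> \<open>Admissibility grants compatibility with nonempty contexts only, so the empty one
    is separate.\<close>
  show "gt M N"
  proof (cases "Z = {#}")
    case False
    then have "Z \<in> monomials D" using assms(4) r by (simp add: monomials_def)
    then show ?thesis using AB r assms(1) unfolding admissible_def by blast
  qed (use AB r in simp)
qed

text \<open>A proper sub-multiset is smaller, so \<open>l\<close> inside \<open>r\<close> would
  contradict the orientation. It guarantees that \<open>compose\<close> does not rewrite a right
  side by the very rule that the step removes.\<close>

lemma oriented_rhs_irreducible:
  assumes "admissible D gtC gt" "oriented D gt R" "(l, r) \<in> R" 
  shows "\<not> l \<subseteq># r"
proof
  assume "l \<subseteq># r"
  have lr: "l \<in> monomials D" "r \<in> monomials D" "gt l r" using assms unfolding oriented_def by auto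
  then have "l \<noteq> r" using admissible_irrefl[OF assms(1)] by blast
  then have "gt r l" using \<open>l \<subseteq># r\<close> lr assms(1) unfolding admissible_def
    by (metis subset_mset.le_imp_less_or_eq)
  then show False using lr admissible_trans[OF assms(1)] admissible_irrefl[OF assms(1)] by blast
qed

lemma completion_step_oriented:
  assumes "admissible D gtC gt" "completion_step gt K (E, R) (E', R')"
    and "E \<subseteq> monomials D \<times> monomials D" "oriented D gt R" "oriented D gt K"
  shows "oriented D gt R'"
proof -
  have RK: "oriented D gt (R \<union> K)" using assms by (auto simp: oriented_def)
  have "R' \<subseteq> monomials D \<times> monomials D"
    using completion_step_monomials[OF assms(2)] assms by (simp add: oriented_def)
  moreover have "\<forall>(l, r)\<in>R'. gt l r" using assms(2)
  proof (cases rule: completion_step.cases)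
    case (compose l r r')
    have lr: "l \<in> monomials D" "r \<in> monomials D" "gt l r"
      using compose assms(4) unfolding oriented_def by auto
    then have "set_mset r \<subseteq> D" by (simp add: monomials_def)
    then have "gt l r'"
      using lr oriented_rewrite[OF assms(1) RK compose(4)] admissible_trans[OF assms(1)] by blast
    then show ?thesis using compose assms(4) unfolding oriented_def by auto
  qed (use assms(4) in \<open>auto simp: oriented_def\<close>)
  ultimately show ?thesis by (simp add: oriented_def)
qed

text \<open>Steps discard equations, so the old system must also follow from the new one. This works
  because the rules used for simplification are still present after the step.\<close>

lemma completion_step_models:
  assumes "admissible D gtC gt" "completion_step gt K (E, R) (E', R')"
    and "E \<subseteq> monomials D \<times> monomials D" "oriented D gt R" "oriented D gt K"
    and "mono_congruence D H" "K \<subseteq> H"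
  shows "E \<union> R \<subseteq> H \<longleftrightarrow> E' \<union> R' \<subseteq> H"
proof -
  note sym = symD[of H] and trans = transD[of H]
  have H: "sym H" "trans H" "\<And>A. A \<in> monomials D \<Longrightarrow> (A, A) \<in> H"
    using assms(6) unfolding mono_congruence_def by blast+
  have RK: "oriented D gt (R \<union> K)" using assms by (auto simp: oriented_def)
  have D: "set_mset s \<subseteq> D \<and> set_mset t \<subseteq> D" if "(s, t) \<in> E \<union> R" for s t
    using that assms(3,4) by (auto simp: oriented_def monomials_def)
  note rw = mono_congruence_rewrite[OF assms(6)]
  from assms(2) show ?thesis
  proof (cases rule: completion_step.cases)
    case (orient s t)
    then show ?thesis using sym[OF H(1)] by auto
  next
    case (delete s)
    then show ?thesis using H(3)[of s] assms(3) by auto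
  next
    case (simplify_left s t s')
    have "(s, s') \<in> H \<and> (s', s) \<in> H" if "R \<subseteq> H"
      using rw[of "R \<union> K" s s'] that simplify_left D[of s t] assms(7) by auto
    then show ?thesis
      using simplify_left trans[OF H(2), of s s' t] trans[OF H(2), of s' s t] by auto
  next
    case (simplify_right s t t')
    have "(t, t') \<in> H \<and> (t', t) \<in> H" if "R \<subseteq> H"
      using rw[of "R \<union> K" t t'] that simplify_right D[of s t] assms(7) by auto
    then show ?thesis
      using simplify_right trans[OF H(2), of s t t'] trans[OF H(2), of s t' t] by auto
  next
    case (deduce s t)
    have "(s, t) \<in> H" if "R \<subseteq> H"
    proof -
      have "R \<union> K \<subseteq> monomials D \<times> monomials D" using RK by (simp add: oriented_def)
      then obtain M where M: "M \<in> monomials D" "(M, s) \<in> mono_rewrite (R \<union> K)"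
          "(M, t) \<in> mono_rewrite (R \<union> K)"
        using critical_pair_monomials deduce(3) by blast
      have RKH: "R \<union> K \<subseteq> H" "set_mset M \<subseteq> D" using that assms(7) M by (auto simp: monomials_def)
      show ?thesis by (rule trans[OF H(2) rw(2)[OF RKH(1) M(2) RKH(2)] rw(1)[OF RKH(1) M(3) RKH(2)]])
    qed
    then show ?thesis using deduce by auto
  next
    case (compose l r r')
    \<comment> \<open>The rule used on \<open>r\<close> is not \<open>(l, r)\<close> itself, so it survives the step.\<close>
    obtain A B where AB: "(A, B) \<in> R \<union> K" "A \<subseteq># r" "r' = r - A + B"
      using compose(4) unfolding mono_rewrite_def by blast
    have "(A, B) \<noteq> (l, r)"
      using oriented_rhs_irreducible[OF assms(1) RK] AB(2) compose(3) by blast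
    then have AB': "(A, B) \<in> R - {(l, r)} \<union> K" using AB(1) by blast
    have "(r, r') \<in> mono_rewrite {(A, B)}" using AB unfolding mono_rewrite_def by blast
    then have "(r, r') \<in> H \<and> (r', r) \<in> H" if "R - {(l, r)} \<subseteq> H"
      using rw[of "{(A, B)}" r r'] that AB' assms(7) D[of l r] compose(3) by auto
    then show ?thesis
      using compose trans[OF H(2), of l r r'] trans[OF H(2), of l r' r] by auto
  next
    case (collapse l r l')
    have "(l, l') \<in> H \<and> (l', l) \<in> H" if "R - {(l, r)} \<subseteq> H"
      using rw[of "R - {(l, r)} \<union> K" l l'] that collapse D[of l r] assms(7) by auto
    then show ?thesis
      using collapse trans[OF H(2), of l l' r] trans[OF H(2), of l' l r] by auto
  qed
qed

lemma completion_steps_sound: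
  assumes "admissible D gtC gt" "(completion_step gt K)\<^sup>*\<^sup>* (E, R) (E', R')"
    and "E \<subseteq> monomials D \<times> monomials D" "oriented D gt R" "oriented D gt K"
  shows "E' \<subseteq> monomials D \<times> monomials D \<and> oriented D gt R' \<and>
    (\<forall>H. mono_congruence D H \<longrightarrow> K \<subseteq> H \<longrightarrow> (E \<union> R \<subseteq> H \<longleftrightarrow> E' \<union> R' \<subseteq> H))"
  using assms(2)
proof (induction rule: rtranclp_induct2)
  case refl
  then show ?case using assms by blast
next
  case (step E1 R1 E2 R2)
  have K: "K \<subseteq> monomials D \<times> monomials D" using assms(5) by (simp add: oriented_def)
  have 1: "E1 \<subseteq> monomials D \<times> monomials D" "oriented D gt R1" using step.IH by auto
  then have "R1 \<subseteq> monomials D \<times> monomials D" by (simp add: oriented_def)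
  note 2 = completion_step_oriented[OF assms(1) step(2) 1 assms(5)]
    completion_step_monomials[OF step(2) 1(1) this K]
    completion_step_models[OF assms(1) step(2) 1 assms(5)]
  show ?case using 2 step.IH by (metis (no_types, lifting))
qed

lemma completes_to_sound:
  assumes "admissible D gtC gt" "completes_to gt K (E, R) R'"
    and "E \<subseteq> monomials D \<times> monomials D" "oriented D gt R" "oriented D gt K"
  shows "oriented D gt R'"
    and "mono_congruence D H \<Longrightarrow> K \<subseteq> H \<Longrightarrow> E \<union> R \<subseteq> H \<longleftrightarrow> R' \<subseteq> H"
    and "\<forall>(s, t)\<in>critical_pairs (R' \<union> K). joinable (R' \<union> K) s t"
  using assms completion_steps_sound[OF assms(1) _ assms(3-5), of "{}" R']
  unfolding completes_to_def by auto

section \<open>Unique normal forms of monomials\<close>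

lemma wf_admissible:
  assumes "admissible D gtC gt"
  shows "wf {(N, M). M \<in> monomials D \<and> N \<in> monomials D \<and> gt M N}"
proof -
  have wfp: "wfp_on (monomials D) (\<lambda>B A. gt A B)" using assms unfolding admissible_def by blast
  show ?thesis unfolding wf_def
  proof (intro allI impI)
    fix P x
    assume step: "\<forall>x. (\<forall>y. (y, x) \<in> {(N, M). M \<in> monomials D \<and> N \<in> monomials D \<and> gt M N} \<longrightarrow> P y) \<longrightarrow> P x"
    show "P x"
    proof (cases "x \<in> monomials D")
      case True
      with wfp show ?thesis by (rule wfp_on_induct) (use step in blast)
    qed (use step in blast)
  qed
qed

lemma wf_oriented:
  assumes "admissible D gtC gt" "oriented D gt R"
  shows "wf {(N, M). (M, N) \<in> mono_rewrite R \<and> set_mset M \<subseteq> D}"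
  by (rule wf_subset[OF wf_admissible[OF assms(1)]]) (use oriented_rewrite[OF assms] in auto)

text \<open>Newman's lemma relative to a closed set \<open>X\<close>, as the orderings are
  well-founded only over the given constants.\<close>

lemma newman:
  assumes wf: "wf {(y, x). (x, y) \<in> r \<and> x \<in> X}"
    and closed: "\<And>x y. (x, y) \<in> r \<Longrightarrow> x \<in> X \<Longrightarrow> y \<in> X"
    and local: "\<And>x y z. x \<in> X \<Longrightarrow> (x, y) \<in> r \<Longrightarrow> (x, z) \<in> r \<Longrightarrow> \<exists>w. (y, w) \<in> r\<^sup>* \<and> (z, w) \<in> r\<^sup>*"
  shows "x \<in> X \<Longrightarrow> (x, y) \<in> r\<^sup>* \<Longrightarrow> (x, z) \<in> r\<^sup>* \<Longrightarrow> \<exists>w. (y, w) \<in> r\<^sup>* \<and> (z, w) \<in> r\<^sup>*"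
  using wf
proof (induction x arbitrary: y z rule: wf_induct_rule)
  case (less x)
  show ?case
  proof (cases "x = y \<or> x = z")
    case True
    then show ?thesis using less.prems by blast
  next
    case False
    obtain y1 where y1: "(x, y1) \<in> r" "(y1, y) \<in> r\<^sup>*"
      using less.prems(2) False by (blast elim: converse_rtranclE)
    obtain z1 where z1: "(x, z1) \<in> r" "(z1, z) \<in> r\<^sup>*"
      using less.prems(3) False by (blast elim: converse_rtranclE)
    obtain w where w: "(y1, w) \<in> r\<^sup>*" "(z1, w) \<in> r\<^sup>*"
      using local[OF less.prems(1) y1(1) z1(1)] by blast
    have X: "y1 \<in> X" "z1 \<in> X" using closed[OF y1(1)] closed[OF z1(1)] less.prems(1) by blast+
    obtain v where v: "(y, v) \<in> r\<^sup>*" "(w, v) \<in> r\<^sup>*" using less.IH[of y1 y w] less.prems X y1 w by blast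
    then have "(z1, v) \<in> r\<^sup>*" using w by (meson rtrancl_trans)
    then obtain v' where "(z, v') \<in> r\<^sup>*" "(v, v') \<in> r\<^sup>*" using less.IH[of z1 z v] less.prems X z1 by blast
    then show ?thesis using v by (meson rtrancl_trans)
  qed
qed

definition mono_nf :: "'c mono_eqs \<Rightarrow> 'c multiset \<Rightarrow> 'c multiset" where
  "mono_nf R M = (SOME N. (M, N) \<in> (mono_rewrite R)\<^sup>* \<and> \<not> reducible R N)"

lemma mono_nf:
  assumes "admissible D gtC gt" "oriented D gt R" "\<forall>(s, t)\<in>critical_pairs R. joinable R s t"
    and "set_mset M \<subseteq> D"
  shows "(M, mono_nf R M) \<in> (mono_rewrite R)\<^sup>*" "\<not> reducible R (mono_nf R M)"
    and "(M, N) \<in> (mono_rewrite R)\<^sup>* \<Longrightarrow> \<not> reducible R N \<Longrightarrow> mono_nf R M = N"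
    and "(M, N) \<in> mono_rewrite R \<Longrightarrow> mono_nf R M = mono_nf R N"
proof -
  let ?X = "{M. set_mset M \<subseteq> D}"
  have wf: "wf {(N, M). (M, N) \<in> mono_rewrite R \<and> M \<in> ?X}"
    using wf_oriented[OF assms(1,2)] by simp
  have closed: "N \<in> ?X" if "(M, N) \<in> mono_rewrite R" "M \<in> ?X" for M N
    using oriented_rewrite(2)[OF assms(1,2) that(1)] that(2) by (simp add: monomials_def)
  have ex: "\<exists>N. (M, N) \<in> (mono_rewrite R)\<^sup>* \<and> \<not> reducible R N" if "M \<in> ?X" for M
    using wf that
  proof (induction M rule: wf_induct_rule)
    case (less M)
    show ?case
    proof (cases "reducible R M")
      case True
      then obtain N where N: "(M, N) \<in> mono_rewrite R" unfolding reducible_def by blast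
      then show ?thesis using less.IH[of N] less.prems closed
        by (metis (mono_tags, lifting) case_prodI converse_rtrancl_into_rtrancl mem_Collect_eq)
    qed blast
  qed
  have nf: "(M, mono_nf R M) \<in> (mono_rewrite R)\<^sup>* \<and> \<not> reducible R (mono_nf R M)" if "M \<in> ?X" for M
    unfolding mono_nf_def using someI_ex[OF ex[OF that]] .
  have confl: "\<exists>w. (N, w) \<in> (mono_rewrite R)\<^sup>* \<and> (N', w) \<in> (mono_rewrite R)\<^sup>*"
    if "(M, N) \<in> (mono_rewrite R)\<^sup>*" "(M, N') \<in> (mono_rewrite R)\<^sup>*" "M \<in> ?X" for M N N'
    
    by (rule newman[OF wf _ _ that(3,1,2)])
      (use closed peak_joinable[OF assms(3)] in \<open>auto simp: joinable_def\<close>)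
  have irred: "N = N'" if "(N, N') \<in> (mono_rewrite R)\<^sup>*" "\<not> reducible R N" for N N'
    using that unfolding reducible_def by (metis DomainI converse_rtranclE)
  have uniq: "mono_nf R M = N" if "(M, N) \<in> (mono_rewrite R)\<^sup>*" "\<not> reducible R N" "M \<in> ?X" for M N
    using confl[OF _ that(1,3)] nf[OF that(3)] irred that by metis
  show "(M, mono_nf R M) \<in> (mono_rewrite R)\<^sup>*" "\<not> reducible R (mono_nf R M)"
    using nf assms(4) by blast+
  show "(M, N) \<in> (mono_rewrite R)\<^sup>* \<Longrightarrow> \<not> reducible R N \<Longrightarrow> mono_nf R M = N"
    using uniq assms(4) by blast
  assume MN: "(M, N) \<in> mono_rewrite R"
  then have "N \<in> ?X" using closed assms(4) by blast
  then show "mono_nf R M = mono_nf R N"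
    using uniq[of M "mono_nf R N"] nf[of N] MN assms(4) by (simp add: converse_rtrancl_into_rtrancl)
qed

section \<open>The combination loop\<close>

lemma mono_congruence_rewrites:
  assumes "mono_congruence D H" "R \<subseteq> H" "R \<subseteq> monomials D \<times> monomials D"
    and "(M, N) \<in> (mono_rewrite R)\<^sup>*" "M \<in> monomials D"
  shows "N \<in> monomials D \<and> (M, N) \<in> H"
  using assms(4)
proof (induction rule: rtrancl_induct)
  case base
  then show ?case using assms by (simp add: mono_congruence_def)
next
  case (step y z)
  have "set_mset y \<subseteq> D" using step by (simp add: monomials_def)
  then have "(y, z) \<in> H" "z \<in> monomials D"
    using mono_congruence_rewrite[OF assms(1,2) step(2)] mono_rewrite_monomials[OF assms(3) step(2)]
    by blast+
  moreover have "trans H" using assms(1) unfolding mono_congruence_def by blast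
  ultimately show ?case using step.IH by (blast dest: transD)
qed

lemma rtrancl_sym_closure: "(c, d) \<in> (E \<union> E\<inverse>)\<^sup>* \<Longrightarrow> (d, c) \<in> (E \<union> E\<inverse>)\<^sup>*"
proof -
  have "sym ((E \<union> E\<inverse>)\<^sup>*)" by (intro sym_rtrancl) (auto simp: sym_def)
  then show "(c, d) \<in> (E \<union> E\<inverse>)\<^sup>* \<Longrightarrow> (d, c) \<in> (E \<union> E\<inverse>)\<^sup>*" by (rule symD)
qed

locale combination =
  fixes D :: "'c set" and F :: "'f set" and gtC :: "'c \<Rightarrow> 'c \<Rightarrow> bool"
    and gt :: "'f \<Rightarrow> 'c multiset \<Rightarrow> 'c multiset \<Rightarrow> bool"
  assumes finite_D: "finite D"
    and total: "strict_total_on D gtC"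
    and adm: "f \<in> F \<Longrightarrow> admissible D gtC (gt f)"
    and nonconst: "f \<in> F \<Longrightarrow> nonconstants_greater D (gt f)"
begin

section \<open>Canonical systems of constant rules\<close>

lemma gtC_asym: "a \<in> D \<Longrightarrow> b \<in> D \<Longrightarrow> gtC a b \<Longrightarrow> gtC b a \<Longrightarrow> False"
  using total unfolding strict_total_on_def transp_on_def irreflp_on_def by blast

lemma finite_least:
  assumes "finite X" "X \<noteq> {}" "X \<subseteq> D"
  shows "\<exists>d\<in>X. \<forall>e\<in>X. e \<noteq> d \<longrightarrow> gtC e d"
  using assms
proof (induction rule: finite_ne_induct)
  case (insert x X)
  then obtain d where d: "d \<in> X" "\<forall>e\<in>X. e \<noteq> d \<longrightarrow> gtC e d" by blast
  have D: "x \<in> D" "X \<subseteq> D" "x \<noteq> d" using insert.prems insert.hyps d(1) by auto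
  then have "gtC x d \<or> gtC d x"
    using total d(1) unfolding strict_total_on_def totalp_on_def by blast
  then show ?case
  proof
    assume "gtC d x"
    then have "\<forall>e\<in>X. gtC e x"
      using d total D unfolding strict_total_on_def transp_on_def by (metis subsetD)
    then show ?thesis by blast
  qed (use d in blast)
qed simp

lemma conversion_carrier:
  assumes "E \<subseteq> D \<times> D" "(c, d) \<in> (E \<union> E\<inverse>)\<^sup>*" "c \<noteq> d"
  shows "c \<in> D" "d \<in> D"
proof -
  show "c \<in> D" using assms(2) by (rule converse_rtranclE) (use assms(1,3) in auto)
  show "d \<in> D" using assms(2) by (rule rtranclE) (use assms(1,3) in auto)
qed

lemma const_nf_least:
  fixes E defines "RC \<equiv> const_canonical gtC E"
  assumes E: "E \<subseteq> D \<times> D"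
  shows "(c, const_nf RC c) \<in> (E \<union> E\<inverse>)\<^sup>*"
    and "(c, e) \<in> (E \<union> E\<inverse>)\<^sup>* \<Longrightarrow> e \<noteq> const_nf RC c \<Longrightarrow> gtC e (const_nf RC c)"
proof -
  let ?X = "{e. (c, e) \<in> (E \<union> E\<inverse>)\<^sup>*}"
  have "\<exists>d\<in>?X. \<forall>e\<in>?X. e \<noteq> d \<longrightarrow> gtC e d"
  proof (cases "c \<in> D")
    case True
    then have "?X \<subseteq> D" using conversion_carrier(2)[OF E] by blast
    moreover have "finite ?X" using finite_subset[OF calculation finite_D] .
    ultimately show ?thesis by (intro finite_least) auto
  next
    case False
    \<comment> \<open>A constant outside \<open>D\<close> is alone in its class, so no membership
      assumption on \<open>c\<close> is needed.\<close>
    then have "?X = {c}" using conversion_carrier(1)[OF E] by blast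
    then show ?thesis by blast
  qed
  then obtain d where d: "(c, d) \<in> (E \<union> E\<inverse>)\<^sup>*" "\<And>e. (c, e) \<in> (E \<union> E\<inverse>)\<^sup>* \<Longrightarrow> e \<noteq> d \<Longrightarrow> gtC e d"
    by blast
  have uniq: "d' = d" if "(c, d') \<in> RC" for d'
  proof (rule ccontr)
    assume ne: "d' \<noteq> d"
    have d': "(c, d') \<in> (E \<union> E\<inverse>)\<^sup>*" "gtC d d'"
      using that ne d(1) unfolding RC_def const_canonical_def by auto
    have "(d', d) \<in> (E \<union> E\<inverse>)\<^sup>*" using rtrancl_trans[OF rtrancl_sym_closure[OF d'(1)] d(1)] .
    then show False using conversion_carrier[OF E _ ne] gtC_asym d' d(2)[OF d'(1) ne] by blast
  qed
  have "const_nf RC c = d"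
  proof (cases "c = d")
    case True
    then have "c \<notin> Domain RC" using uniq unfolding RC_def const_canonical_def by blast
    then show ?thesis using True by (simp add: const_nf_def)
  next
    case False
    then have "(c, d) \<in> RC" using d unfolding RC_def const_canonical_def by blast
    moreover have "(THE d. (c, d) \<in> RC) = d" using calculation uniq by (rule the_equality)
    ultimately show ?thesis by (auto simp: const_nf_def)
  qed
  then show "(c, const_nf RC c) \<in> (E \<union> E\<inverse>)\<^sup>*"
    "(c, e) \<in> (E \<union> E\<inverse>)\<^sup>* \<Longrightarrow> e \<noteq> const_nf RC c \<Longrightarrow> gtC e (const_nf RC c)"
    using d by blast+
qed

text \<open>Two different least constants of one class would each have to exceed the other.\<close>

lemma const_nf_eq_iff:
  assumes "E \<subseteq> D \<times> D"
  shows "const_nf (const_canonical gtC E) c = const_nf (const_canonical gtC E) d \<longleftrightarrow>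
    (c, d) \<in> (E \<union> E\<inverse>)\<^sup>*" (is "?n c = ?n d \<longleftrightarrow> _")
proof
  note n = const_nf_least[OF assms]
  show "(c, d) \<in> (E \<union> E\<inverse>)\<^sup>*" if "?n c = ?n d"
    using rtrancl_trans[OF n(1)[of c] rtrancl_sym_closure[OF n(1)[of d, folded that]]] .
  assume cd: "(c, d) \<in> (E \<union> E\<inverse>)\<^sup>*"
  show "?n c = ?n d"
  proof (rule ccontr)
    assume ne: "?n c \<noteq> ?n d"
    have 1: "(c, ?n d) \<in> (E \<union> E\<inverse>)\<^sup>*" using rtrancl_trans[OF cd n(1)] .
    have 2: "(d, ?n c) \<in> (E \<union> E\<inverse>)\<^sup>*" using rtrancl_trans[OF rtrancl_sym_closure[OF cd] n(1)] .
    have "(?n c, ?n d) \<in> (E \<union> E\<inverse>)\<^sup>*" using rtrancl_trans[OF rtrancl_sym_closure[OF n(1)] 1] .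
    then have "?n c \<in> D" "?n d \<in> D" using conversion_carrier[OF assms _ ne] by blast+
    then show False using n(2)[OF 1] n(2)[OF 2] ne gtC_asym by metis
  qed
qed

text \<open>The generating equations change in every round, so they are hidden behind an
  existential.\<close>

definition canonical_consts :: "'c rel \<Rightarrow> bool" where
  "canonical_consts RC \<longleftrightarrow> (\<exists>E. E \<subseteq> D \<times> D \<and> RC = const_canonical gtC E)"

lemma canonical_consts_iff:
  assumes "canonical_consts RC"
  shows "(c, d) \<in> RC \<longleftrightarrow> d = const_nf RC c \<and> c \<noteq> d"
proof -
  obtain E where E: "E \<subseteq> D \<times> D" "RC = const_canonical gtC E"
    using assms unfolding canonical_consts_def by blast
  note n = const_nf_least[OF E(1), folded E(2)]
  have "d = const_nf RC c" if "(c, d) \<in> RC"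
  proof (rule ccontr)
    assume ne: "d \<noteq> const_nf RC c"
    have d: "(c, d) \<in> (E \<union> E\<inverse>)\<^sup>*" "gtC (const_nf RC c) d"
      using that ne n(1)[of c] unfolding E(2) const_canonical_def by auto
    have "(d, const_nf RC c) \<in> (E \<union> E\<inverse>)\<^sup>*"
      using rtrancl_trans[OF rtrancl_sym_closure[OF d(1)] n(1)] .
    then show False using conversion_carrier[OF E(1) _ ne] n(2)[OF d(1) ne] d(2) gtC_asym by blast
  qed
  moreover have "c \<noteq> d" if "(c, d) \<in> RC" using that unfolding E(2) const_canonical_def by blast
  moreover have "(c, const_nf RC c) \<in> RC" if "c \<noteq> const_nf RC c"
    using that n[of c] unfolding E(2) const_canonical_def by blast
  ultimately show ?thesis by blast
qed

lemma canonical_consts_props: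
  assumes "canonical_consts RC"
  shows "RC \<subseteq> D \<times> D" "(c, d) \<in> RC \<Longrightarrow> gtC c d"
    and "const_nf RC (const_nf RC c) = const_nf RC c"
proof -
  obtain E where E: "E \<subseteq> D \<times> D" "RC = const_canonical gtC E"
    using assms unfolding canonical_consts_def by blast
  note n = const_nf_least[OF E(1), folded E(2)]
  show "RC \<subseteq> D \<times> D"
    using conversion_carrier[OF E(1)] unfolding E(2) const_canonical_def by blast
  show "(c, d) \<in> RC \<Longrightarrow> gtC c d" unfolding E(2) const_canonical_def by blast
  show "const_nf RC (const_nf RC c) = const_nf RC c"
    using const_nf_eq_iff[OF E(1), folded E(2)] n(1) rtrancl_sym_closure by metis
qed

lemma const_nf_carrier: "canonical_consts RC \<Longrightarrow> c \<in> D \<Longrightarrow> const_nf RC c \<in> D"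
  using canonical_consts_iff canonical_consts_props(1) by (metis SigmaD2 subsetD)

lemma const_nf_less:
  assumes "canonical_consts RC" "c \<in> D" "d \<in> D" "const_nf RC c = const_nf RC d" "gtC c d"
  shows "c \<in> Domain RC"
proof (rule ccontr)
  assume "c \<notin> Domain RC"
  then have c: "const_nf RC c = c" by (simp add: const_nf_def)
  have "c \<noteq> d" using gtC_asym assms by blast
  then have "(d, c) \<in> RC" using c assms canonical_consts_iff by metis
  then show False using canonical_consts_props(2)[OF assms(1)] gtC_asym assms by blast
qed

lemma Domain_iff_const_nf: "canonical_consts RC \<Longrightarrow> c \<in> Domain RC \<longleftrightarrow> const_nf RC c \<noteq> c"
  using canonical_consts_iff by (auto simp: Domain_iff)

section \<open>Constant rules acting on monomials\<close>

lemma as_mono_rules_oriented: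
  assumes "f \<in> F" "canonical_consts RC"
  shows "oriented D (gt f) (as_mono_rules RC)"
proof -
  have "gt f {#c#} {#d#}" if "(c, d) \<in> RC" for c d
    using that canonical_consts_props[OF assms(2)] adm[OF assms(1)] unfolding admissible_def by blast
  then show ?thesis using canonical_consts_props(1)[OF assms(2)]
    by (auto simp: oriented_def as_mono_rules_def monomials_def)
qed

lemma reducible_as_mono_rules: "reducible (as_mono_rules RC) M \<longleftrightarrow> (\<exists>c\<in>#M. c \<in> Domain RC)"
proof
  show "reducible (as_mono_rules RC) M \<Longrightarrow> \<exists>c\<in>#M. c \<in> Domain RC"
    unfolding reducible_def mono_rewrite_iff Domain_iff as_mono_rules_def by auto
  show "\<exists>c\<in>#M. c \<in> Domain RC \<Longrightarrow> reducible (as_mono_rules RC) M"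
    unfolding reducible_def mono_rewrite_def as_mono_rules_def by fastforce
qed

lemma image_const_nf_irreducible:
  assumes "canonical_consts RC" "\<not> reducible (as_mono_rules RC) M"
  shows "image_mset (const_nf RC) M = M"
proof -
  have "image_mset (const_nf RC) M = image_mset id M"
    by (rule image_mset_cong) (use assms in \<open>auto simp: reducible_as_mono_rules Domain_iff_const_nf\<close>)
  then show ?thesis by simp
qed

lemma rewrites_image_const_nf:
  assumes "canonical_consts RC"
  shows "(M, image_mset (const_nf RC) M) \<in> (mono_rewrite (as_mono_rules RC))\<^sup>*"
proof (induction M)
  case (add c M)
  have "({#c#}, {#const_nf RC c#}) \<in> (mono_rewrite (as_mono_rules RC))\<^sup>*"
  proof (cases "const_nf RC c = c")
    case False
    then have "(c, const_nf RC c) \<in> RC" using canonical_consts_iff[OF assms] by simp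
    then show ?thesis by (auto simp: as_mono_rules_def intro!: r_into_rtrancl mono_rewrite_rule)
  qed simp
  then have "({#c#} + image_mset (const_nf RC) M, {#const_nf RC c#} + image_mset (const_nf RC) M)
      \<in> (mono_rewrite (as_mono_rules RC))\<^sup>*" by (rule mono_rewrites_add)
  moreover have "(M + {#c#}, image_mset (const_nf RC) M + {#c#}) \<in> (mono_rewrite (as_mono_rules RC))\<^sup>*"
    using add by (rule mono_rewrites_add)
  ultimately show ?case by simp
qed simp

text \<open>Under normalization of constants, a step by \<open>RC0\<close> becomes an identity
  because \<open>RC\<close> has merged its two sides. A rule of \<open>R\<close> keeps its left
  side, which contains no reducible constant, and only its right side still has to be
  normalized.\<close>

lemma rewrite_image_const_nf:
  assumes "canonical_consts RC" "\<not> needs_update RC R" "\<forall>(c, d)\<in>RC0. const_nf RC c = const_nf RC d"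
    and "(M, N) \<in> mono_rewrite (R \<union> as_mono_rules RC0)"
  shows "(image_mset (const_nf RC) M, image_mset (const_nf RC) N)
    \<in> (mono_rewrite (R \<union> as_mono_rules RC))\<^sup>*"
proof -
  let ?k = "image_mset (const_nf RC)"
  obtain A B Z where AB: "(A, B) \<in> R \<union> as_mono_rules RC0" "M = A + Z" "N = B + Z"
    using assms(4) unfolding mono_rewrite_iff by blast
  have "(?k A, ?k B) \<in> (mono_rewrite (R \<union> as_mono_rules RC))\<^sup>*"
  proof (cases "(A, B) \<in> R")
    case True
    then have "?k A = A" using assms(2) image_const_nf_irreducible[OF assms(1)]
      by (auto simp: needs_update_def)
    moreover have "(A, B) \<in> mono_rewrite (R \<union> as_mono_rules RC)"
      using True by (simp add: mono_rewrite_rule)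
    moreover have "(B, ?k B) \<in> (mono_rewrite (R \<union> as_mono_rules RC))\<^sup>*"
      using rewrites_image_const_nf[OF assms(1), of B]
        rtrancl_mono[OF mono_rewrite_mono[of "as_mono_rules RC" "R \<union> as_mono_rules RC"]] by blast
    ultimately show ?thesis by (simp add: converse_rtrancl_into_rtrancl)
  next
    case False
    then show ?thesis using AB(1) assms(3) by (auto simp: as_mono_rules_def)
  qed
  then show ?thesis using AB mono_rewrites_add by fastforce
qed

text \<open>All joins happen between images under \<open>const_nf RC\<close>. For two rules of
  \<open>R\<close> the old joining sequences are mapped over. If one rule is a constant rule, its
  side of the peak has the same image as the peak, and the image of the other step completes the
  join.\<close>

lemma not_needs_update_critical_pairs:
  assumes "canonical_consts RC" "\<not> needs_update RC R" "\<forall>(c, d)\<in>RC0. const_nf RC c = const_nf RC d"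
    and "\<forall>(s, t)\<in>critical_pairs R. joinable (R \<union> as_mono_rules RC0) s t"
  shows "\<forall>(s, t)\<in>critical_pairs (R \<union> as_mono_rules RC). joinable (R \<union> as_mono_rules RC) s t"
proof safe
  fix s t assume "(s, t) \<in> critical_pairs (R \<union> as_mono_rules RC)"
  let ?k = "image_mset (const_nf RC)" and ?r = "mono_rewrite (R \<union> as_mono_rules RC)"
  have idem: "\<forall>(c, d)\<in>RC. const_nf RC c = const_nf RC d"
    using canonical_consts_iff[OF assms(1)] canonical_consts_props(3)[OF assms(1)] by auto
  have k: "(M, ?k M) \<in> ?r\<^sup>*" for M
    using rewrites_image_const_nf[OF assms(1), of M]
      rtrancl_mono[OF mono_rewrite_mono[of "as_mono_rules RC" "R \<union> as_mono_rules RC"]] by blast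
  have same: "?k M = ?k N"
    if MN: "(M, N) \<in> mono_rewrite {(A, B)}" and AB: "(A, B) \<in> as_mono_rules RC" for M N A B
  proof -
    obtain Z where "M = A + Z" "N = B + Z" using MN unfolding mono_rewrite_iff by blast
    then show ?thesis using AB idem by (auto simp: as_mono_rules_def)
  qed
  have kr: "(?k M, ?k N) \<in> ?r\<^sup>*" if "(M, N) \<in> mono_rewrite {(A, B)}" "(A, B) \<in> R \<union> as_mono_rules RC"
    for M N A B
    using rewrite_image_const_nf[OF assms(1,2) idem, of M N] that
      mono_rewrite_mono[of "{(A, B)}" "R \<union> as_mono_rules RC"] by blast
  obtain A1 A2 B1 B2 M where p: "(A1, A2) \<in> R \<union> as_mono_rules RC" "(B1, B2) \<in> R \<union> as_mono_rules RC"
      "s = (A1 + B1 - A1 \<inter># B1 - A1) + A2" "t = (A1 + B1 - A1 \<inter># B1 - B1) + B2"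
      "(M, s) \<in> mono_rewrite {(A1, A2)}" "(M, t) \<in> mono_rewrite {(B1, B2)}"
  proof -
    obtain A1 A2 B1 B2 where p: "(A1, A2) \<in> R \<union> as_mono_rules RC" "(B1, B2) \<in> R \<union> as_mono_rules RC"
      "s = (A1 + B1 - A1 \<inter># B1 - A1) + A2" "t = (A1 + B1 - A1 \<inter># B1 - B1) + B2"
      using \<open>(s, t) \<in> _\<close> unfolding critical_pairs_def by blast
    let ?M = "A1 + B1 - A1 \<inter># B1"
    have "A1 \<subseteq># ?M" unfolding critical_overlap(1) by simp
    then have "(?M, s) \<in> mono_rewrite {(A1, A2)}" using p(3) unfolding mono_rewrite_def by blast
    moreover have "B1 \<subseteq># ?M" unfolding critical_overlap(2) by simp
    then have "(?M, t) \<in> mono_rewrite {(B1, B2)}" using p(4) unfolding mono_rewrite_def by blast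
    ultimately show thesis using that p by blast
  qed
  show "joinable (R \<union> as_mono_rules RC) s t"
  proof (cases "(A1, A2) \<in> R \<and> (B1, B2) \<in> R")
    case True
    then have "(s, t) \<in> critical_pairs R" unfolding critical_pairs_def using p by blast
    then obtain K where K: "(s, K) \<in> (mono_rewrite (R \<union> as_mono_rules RC0))\<^sup>*"
        "(t, K) \<in> (mono_rewrite (R \<union> as_mono_rules RC0))\<^sup>*"
      using assms(4) unfolding joinable_def by blast
    have "(?k M, ?k N) \<in> ?r\<^sup>*" if "(M, N) \<in> (mono_rewrite (R \<union> as_mono_rules RC0))\<^sup>*" for M N
      using that
    proof (induction rule: rtrancl_induct)
      case (step y z)
      then show ?case using rewrite_image_const_nf[OF assms(1-3) step(2)] by (meson rtrancl_trans)
    qed simp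
    then have "(s, ?k K) \<in> ?r\<^sup>*" "(t, ?k K) \<in> ?r\<^sup>*" using K k by (meson rtrancl_trans)+
    then show ?thesis unfolding joinable_def by blast
  next
    case False
    then consider "(A1, A2) \<in> as_mono_rules RC" | "(B1, B2) \<in> as_mono_rules RC" using p by blast
    then show ?thesis
    proof cases
      case 1
      have "(?k s, ?k t) \<in> ?r\<^sup>*" using same[OF p(5) 1] kr[OF p(6,2)] by simp
      then have "(s, ?k t) \<in> ?r\<^sup>*" using k by (meson rtrancl_trans)
      then show ?thesis using k unfolding joinable_def by blast
    next
      case 2
      have "(?k t, ?k s) \<in> ?r\<^sup>*" using same[OF p(6) 2] kr[OF p(5,1)] by simp
      then have "(t, ?k s) \<in> ?r\<^sup>*" using k by (meson rtrancl_trans)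
      then show ?thesis using k unfolding joinable_def by blast
    qed
  qed
qed

section \<open>Constant rules generated by completion\<close>

lemma const_rule_gtC:
  assumes "f \<in> F" "oriented D (gt f) R" "(c, d) \<in> const_rules R"
  shows "c \<in> D" "d \<in> D" "gtC c d"
proof -
  have m: "{#c#} \<in> monomials D" "{#d#} \<in> monomials D" "gt f {#c#} {#d#}"
    using assms(2,3) unfolding oriented_def const_rules_def by auto
  then show cd: "c \<in> D" "d \<in> D" by (auto simp: monomials_def)
  have "c \<noteq> d" using admissible_irrefl[OF adm[OF assms(1)]] m by blast
  moreover have "\<not> gtC d c"
  proof
    assume "gtC d c"
    then have "gt f {#d#} {#c#}" using cd adm[OF assms(1)] unfolding admissible_def by blast
    then show False using m admissible_trans[OF adm[OF assms(1)]] admissible_irrefl[OF adm[OF assms(1)]]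
      by blast
  qed
  ultimately show "gtC c d"
    using total cd unfolding strict_total_on_def totalp_on_def by blast
qed

text \<open>Since \<open>gtC\<close> is total, \<open>gt f\<close> agrees with it on constants, and
  the left side of the rule is not least in its class. So a system whose constant rules have been
  merged into \<open>RC\<close> is always recompleted, and none of these rules can linger in an
  untouched system.\<close>

lemma const_rules_needs_update:
  assumes "f \<in> F" "canonical_consts RC" "oriented D (gt f) R" "(c, d) \<in> const_rules R"
    and "const_nf RC c = const_nf RC d"
  shows "needs_update RC R"
proof -
  have "c \<in> Domain RC" using const_nf_less[OF assms(2)] const_rule_gtC[OF assms(1,3,4)] assms(5) by blast
  then have "reducible (as_mono_rules RC) {#c#}" by (simp add: reducible_as_mono_rules)
  then show ?thesis using assms(4) unfolding needs_update_def const_rules_def by blast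
qed

text \<open>The congruence that ACCC(E) induces on \<open>f\<close>-monomials. Quantifying over all
  bracketings makes transitivity and closure under contexts independent of a choice of
  terms.\<close>

definition holds :: "('c, 'f) gterm rel \<Rightarrow> 'f \<Rightarrow> 'c multiset rel" where
  "holds E f = {(A, B). A \<in> monomials D \<and> B \<in> monomials D \<and>
    (\<forall>s t. mono_term f A s \<longrightarrow> mono_term f B t \<longrightarrow> (s, t) \<in> accc D F E)}"

lemma mono_congruence_holds:
  assumes "f \<in> F"
  shows "mono_congruence D (holds E f)"
  unfolding mono_congruence_def
proof (intro conjI ballI allI impI)
  show "(A, A) \<in> holds E f" if "A \<in> monomials D" for A
    using that assms mono_term_accc[of f A _ _ F D E] unfolding holds_def monomials_def by blast
  show "sym (holds E f)" unfolding holds_def sym_def using accc.sym by blast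
  show "trans (holds E f)"
  proof (rule transI)
    fix X Y Z assume XY: "(X, Y) \<in> holds E f" and YZ: "(Y, Z) \<in> holds E f"
    then obtain v where "mono_term f Y v"
      using mono_term_exists[of Y f] unfolding holds_def monomials_def by blast
    then show "(X, Z) \<in> holds E f" using XY YZ accc.trans unfolding holds_def by blast
  qed
  fix A B Z assume AB: "(A, B) \<in> holds E f" and Z: "set_mset Z \<subseteq> D"
  show "(A + Z, B + Z) \<in> holds E f"
  proof (cases "Z = {#}")
    case False
    have A: "A \<noteq> {#}" "set_mset (A + Z) \<subseteq> D" and B: "B \<noteq> {#}" "set_mset (B + Z) \<subseteq> D"
      using AB Z unfolding holds_def monomials_def by auto
    have "(s, t) \<in> accc D F E" if s: "mono_term f (A + Z) s" and t: "mono_term f (B + Z) t" for s t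
    proof -
      obtain a b z where abz: "mono_term f A a" "mono_term f B b" "mono_term f Z z"
        using mono_term_exists A B False by metis
      have "(s, App f a z) \<in> accc D F E"
        using mono_term_accc[OF s mono_term.app[OF abz(1,3)] assms A(2)] .
      moreover have "(App f b z, t) \<in> accc D F E"
        using mono_term_accc[OF mono_term.app[OF abz(2,3)] t assms B(2)] .
      moreover have "(App f a z, App f b z) \<in> accc D F E"
        using AB abz assms mono_term_accc[OF abz(3,3) assms Z] unfolding holds_def
        by (blast intro: accc.cong)
      ultimately show ?thesis using accc.trans by blast
    qed
    then show ?thesis using A B unfolding holds_def monomials_def by auto
  qed (use AB in simp)
qed

definition consts_hold :: "('c, 'f) gterm rel \<Rightarrow> 'c rel \<Rightarrow> bool" where
  "consts_hold E RC \<longleftrightarrow> (\<forall>(c, d)\<in>RC. (Const c, Const d) \<in> accc D F E)"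

text \<open>Satisfaction by an arbitrary test set \<open>E\<close>. The condition couples the
  symbols through the shared constants, yet splits into one condition per symbol, so each completion
  can be treated alone.\<close>

definition models :: "('c, 'f) gterm rel \<Rightarrow> 'c rel \<Rightarrow> ('f \<Rightarrow> 'c mono_eqs) \<Rightarrow> bool" where
  "models E RC RF \<longleftrightarrow> consts_hold E RC \<and> (\<forall>f\<in>F. RF f \<subseteq> holds E f)"

lemma consts_hold_const_canonical:
  assumes "N \<subseteq> D \<times> D"
  shows "consts_hold E (const_canonical gtC N) \<longleftrightarrow> consts_hold E N"
proof
  let ?n = "const_nf (const_canonical gtC N)"
  assume h: "consts_hold E (const_canonical gtC N)"
  have cc: "canonical_consts (const_canonical gtC N)" using assms unfolding canonical_consts_def by blast
  have n: "(Const c, Const (?n c)) \<in> accc D F E" if "c \<in> D" for c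
  proof (cases "?n c = c")
    case True
    then show ?thesis using that by (auto intro!: accc.refl gterms.const)
  next
    case False
    then have "(c, ?n c) \<in> const_canonical gtC N" using canonical_consts_iff[OF cc, of c "?n c"] by simp
    then show ?thesis using h unfolding consts_hold_def by blast
  qed
  show "consts_hold E N" unfolding consts_hold_def
  proof safe
    fix c d assume cd: "(c, d) \<in> N"
    then have eq: "?n c = ?n d" using const_nf_eq_iff[OF assms] by blast
    have "c \<in> D" "d \<in> D" using cd assms by auto
    from n[OF this(1)] accc.sym[OF n[OF this(2)], folded eq]
    show "(Const c, Const d) \<in> accc D F E" by (rule accc.trans)
  qed
next
  assume h: "consts_hold E N"
  have "(Const c, Const d) \<in> accc D F E" if "(c, d) \<in> (N \<union> N\<inverse>)\<^sup>*" "c \<in> D" for c d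
    using that
  proof (induction rule: rtrancl_induct)
    case base
    then show ?case by (auto intro!: accc.refl gterms.const)
  next
    case (step y z)
    have "(Const y, Const z) \<in> accc D F E"
      using step(2) h accc.sym unfolding consts_hold_def by blast
    then show ?case using step.IH[OF step.prems] accc.trans by blast
  qed
  then show "consts_hold E (const_canonical gtC N)"
    using conversion_carrier(1)[OF assms] unfolding consts_hold_def const_canonical_def by blast
qed

lemma as_mono_rules_holds:
  "RC \<subseteq> D \<times> D \<Longrightarrow> consts_hold E RC \<Longrightarrow> as_mono_rules RC \<subseteq> holds E f"
  unfolding consts_hold_def holds_def as_mono_rules_def monomials_def
  by (auto simp: mono_term_singleton)

lemma const_rules_hold:
  assumes "models E RC RF"
  shows "consts_hold E (\<Union>f\<in>F. const_rules (RF f))"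
  unfolding consts_hold_def
proof safe
  fix f c d assume "f \<in> F" "(c, d) \<in> const_rules (RF f)"
  then have "({#c#}, {#d#}) \<in> holds E f" using assms unfolding models_def const_rules_def by blast
  then show "(Const c, Const d) \<in> accc D F E" unfolding holds_def by (simp add: mono_term_singleton)
qed

section \<open>Invariant and exit of the loop\<close>

definition final :: "'c rel \<Rightarrow> ('f \<Rightarrow> 'c mono_eqs) \<Rightarrow> bool" where
  "final RC RF \<longleftrightarrow> canonical_consts RC \<and>
    (\<forall>f\<in>F. oriented D (gt f) (RF f) \<and> const_rules (RF f) = {} \<and>
      (\<forall>(s, t)\<in>critical_pairs (RF f \<union> as_mono_rules RC). joinable (RF f \<union> as_mono_rules RC) s t))"

text \<open>At the head of the loop a system \<open>RF f\<close> is canonical together with some earlier constant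
  rules \<open>RC0\<close>, which the current ones subsume.\<close>

definition loop_inv :: "'c rel \<Rightarrow> ('f \<Rightarrow> 'c mono_eqs) \<Rightarrow> bool" where
  "loop_inv RC RF \<longleftrightarrow> canonical_consts RC \<and>
    (\<forall>f\<in>F. oriented D (gt f) (RF f) \<and>
      (\<forall>(c, d)\<in>const_rules (RF f). const_nf RC c = const_nf RC d) \<and>
      (\<exists>RC0. (\<forall>(c, d)\<in>RC0. const_nf RC c = const_nf RC d) \<and>
        (\<forall>(s, t)\<in>critical_pairs (RF f). joinable (RF f \<union> as_mono_rules RC0) s t)))"

lemma critical_pairs_mono: "R \<subseteq> R' \<Longrightarrow> critical_pairs R \<subseteq> critical_pairs R'"
  unfolding critical_pairs_def by blast

lemma not_needs_update:
  assumes "loop_inv RC RF" "f \<in> F" "\<not> needs_update RC (RF f)"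
  shows "const_rules (RF f) = {}"
    and "\<forall>(s, t)\<in>critical_pairs (RF f \<union> as_mono_rules RC). joinable (RF f \<union> as_mono_rules RC) s t"
proof -
  have cc: "canonical_consts RC" and o: "oriented D (gt f) (RF f)"
    and c: "\<forall>(c, d)\<in>const_rules (RF f). const_nf RC c = const_nf RC d"
    using assms unfolding loop_inv_def by blast+
  show "const_rules (RF f) = {}"
    using const_rules_needs_update[OF assms(2) cc o] c assms(3) by fastforce
  obtain RC0 where "\<forall>(c, d)\<in>RC0. const_nf RC c = const_nf RC d"
      "\<forall>(s, t)\<in>critical_pairs (RF f). joinable (RF f \<union> as_mono_rules RC0) s t"
    using assms unfolding loop_inv_def by blast
  then show "\<forall>(s, t)\<in>critical_pairs (RF f \<union> as_mono_rules RC). joinable (RF f \<union> as_mono_rules RC) s t"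
    by (rule not_needs_update_critical_pairs[OF cc assms(3)])
qed

text \<open>\<open>NNR\<close> collects the rules of updated symbols only, but untouched systems
  contain no constant rule, so it accounts for all of them. An empty \<open>NNR\<close> thus
  certifies that every constant rule sits in \<open>RC\<close>.\<close>

lemma update_round_sound:
  assumes "loop_inv RC RF" "update_round F gt RC RF RF' NNR"
  shows "NNR = (\<Union>f\<in>F. const_rules (RF' f))"
    and "f \<in> F \<Longrightarrow> oriented D (gt f) (RF' f) \<and>
      (\<forall>(s, t)\<in>critical_pairs (RF' f \<union> as_mono_rules RC). joinable (RF' f \<union> as_mono_rules RC) s t)"
    and "models E RC RF \<longleftrightarrow> models E RC RF'"
proof -
  have cc: "canonical_consts RC" using assms(1) unfolding loop_inv_def by blast
  obtain NR where NR: "\<And>f. f \<in> F \<Longrightarrow> if needs_update RC (RF f)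
        then update_AC (RF f) RC (gt f) (RF' f) (NR f) else RF' f = RF f \<and> NR f = {}"
      "NNR = (\<Union>f\<in>F. NR f)"
    using assms(2) unfolding update_round_def by blast
  have main: "NR f = const_rules (RF' f) \<and> oriented D (gt f) (RF' f) \<and>
      (\<forall>(s, t)\<in>critical_pairs (RF' f \<union> as_mono_rules RC). joinable (RF' f \<union> as_mono_rules RC) s t) \<and>
      (\<forall>E. consts_hold E RC \<longrightarrow> (RF f \<subseteq> holds E f \<longleftrightarrow> RF' f \<subseteq> holds E f))"
    if f: "f \<in> F" for f
  proof (cases "needs_update RC (RF f)")
    case True
    define K where "K = as_mono_rules RC"
    define red where "red = {(l, r) \<in> RF f. reducible K l}"
    have up: "completes_to (gt f) K (red, RF f - red) (RF' f)" "NR f = const_rules (RF' f)"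
      using NR(1)[OF f] True unfolding update_AC_def red_def K_def Let_def by auto
    have "oriented D (gt f) (RF f)" using assms(1) f unfolding loop_inv_def by blast
    moreover have "red \<subseteq> RF f" by (auto simp: red_def)
    ultimately have o: "red \<subseteq> monomials D \<times> monomials D" "oriented D (gt f) (RF f - red)"
      unfolding oriented_def by auto
    have oK: "oriented D (gt f) K" unfolding K_def using as_mono_rules_oriented[OF f cc] .
    have "red \<union> (RF f - red) = RF f" using \<open>red \<subseteq> RF f\<close> by blast
    then have "RF f \<subseteq> holds E f \<longleftrightarrow> RF' f \<subseteq> holds E f" if "consts_hold E RC" for E
      using completes_to_sound(2)[OF adm[OF f] up(1) o oK mono_congruence_holds[OF f]]
        as_mono_rules_holds[OF canonical_consts_props(1)[OF cc] that] unfolding K_def by metis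
    then show ?thesis
      using completes_to_sound(1,3)[OF adm[OF f] up(1) o oK] up(2) unfolding K_def by blast
  next
    case False
    then have "RF' f = RF f" "NR f = {}" using NR(1)[OF f] by auto
    moreover have "oriented D (gt f) (RF f)" using assms(1) f unfolding loop_inv_def by blast
    ultimately show ?thesis using not_needs_update[OF assms(1) f False] by simp
  qed
  show "NNR = (\<Union>f\<in>F. const_rules (RF' f))" using NR(2) main by auto
  show "f \<in> F \<Longrightarrow> oriented D (gt f) (RF' f) \<and>
      (\<forall>(s, t)\<in>critical_pairs (RF' f \<union> as_mono_rules RC). joinable (RF' f \<union> as_mono_rules RC) s t)"
    using main by blast
  show "models E RC RF \<longleftrightarrow> models E RC RF'" using main unfolding models_def by blast
qed

lemma update_C_sound:
  fixes RF NNR RC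
  defines "NNR \<equiv> (\<Union>f\<in>F. const_rules (RF f))"
  defines "RC' \<equiv> update_C gtC RC NNR"
  assumes "canonical_consts RC" "\<And>f. f \<in> F \<Longrightarrow> oriented D (gt f) (RF f)"
  shows "canonical_consts RC'" "models E RC' RF \<longleftrightarrow> models E RC RF"
    and "(c, d) \<in> RC \<union> NNR \<Longrightarrow> const_nf RC' c = const_nf RC' d"
proof -
  have D: "RC \<union> NNR \<subseteq> D \<times> D"
    using canonical_consts_props(1)[OF assms(3)] const_rule_gtC(1,2)[OF _ assms(4)]
    unfolding NNR_def by auto
  then show "canonical_consts RC'" unfolding canonical_consts_def RC'_def update_C_def by blast
  show "(c, d) \<in> RC \<union> NNR \<Longrightarrow> const_nf RC' c = const_nf RC' d"
    using const_nf_eq_iff[OF D] unfolding RC'_def update_C_def by blast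
  have "consts_hold E RC' \<longleftrightarrow> consts_hold E RC \<and> consts_hold E NNR"
    using consts_hold_const_canonical[OF D] unfolding RC'_def update_C_def consts_hold_def by blast
  then show "models E RC' RF \<longleftrightarrow> models E RC RF"
    using const_rules_hold unfolding models_def NNR_def by blast
qed

lemma update_loop_sound:
  assumes "update_loop F gtC gt RC RF RC' RF'" "loop_inv RC RF"
  shows "final RC' RF' \<and> (\<forall>E. models E RC RF \<longleftrightarrow> models E RC' RF')"
  using assms
proof (induction rule: update_loop.induct)
  case (stop RC RF RF')
  note u = update_round_sound[OF stop(2,1)]
  have "canonical_consts RC" using stop unfolding loop_inv_def by blast
  then show ?case using u unfolding final_def by blast
next
  case (continue RC RF RF' NNR RC'' RF'')
  note u = update_round_sound[OF continue.prems continue.hyps(1)]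
  have cc: "canonical_consts RC" using continue.prems unfolding loop_inv_def by blast
  note c = update_C_sound[OF cc, of RF', folded u(1)]
  have o: "\<And>f. f \<in> F \<Longrightarrow> oriented D (gt f) (RF' f)" using u(2) by blast
  have "loop_inv (update_C gtC RC NNR) RF'" unfolding loop_inv_def
  proof (intro conjI ballI)
    show "canonical_consts (update_C gtC RC NNR)" using c(1) o by blast
    fix f assume f: "f \<in> F"
    show "oriented D (gt f) (RF' f)" using o f by blast
    show "case p of (c, d) \<Rightarrow> const_nf (update_C gtC RC NNR) c = const_nf (update_C gtC RC NNR) d"
      if "p \<in> const_rules (RF' f)" for p
      using c(3)[OF o] that f u(1) by (cases p) blast
    \<comment> \<open>The constant rules used in this round become the earlier system
      \<open>RC0\<close> of the invariant.\<close>
    have "\<forall>(s, t)\<in>critical_pairs (RF' f). joinable (RF' f \<union> as_mono_rules RC) s t"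
      using u(2)[OF f] critical_pairs_mono[of "RF' f" "RF' f \<union> as_mono_rules RC"] by blast
    then show "\<exists>RC0. (\<forall>(c, d)\<in>RC0. const_nf (update_C gtC RC NNR) c = const_nf (update_C gtC RC NNR) d) \<and>
        (\<forall>(s, t)\<in>critical_pairs (RF' f). joinable (RF' f \<union> as_mono_rules RC0) s t)"
      using c(3)[OF o] by (intro exI[of _ RC]) blast
  qed
  then show ?case using continue.IH u(3) c(2)[OF o] by blast
qed

theorem combination_mult_AC_sound:
  assumes "combination_mult_AC F gtC gt SC SF RC RF"
    and "SC \<subseteq> D \<times> D" "\<And>f. f \<in> F \<Longrightarrow> SF f \<subseteq> monomials D \<times> monomials D"
  shows "final RC RF" "models E SC SF \<longleftrightarrow> models E RC RF"
proof -
  define RC0 where "RC0 = const_canonical gtC SC"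
  define k where "k = image_mset (const_nf RC0)"
  define SF0 where "SF0 f = map_prod k k ` SF f" for f
  obtain RF0 where RF0: "\<And>f. f \<in> F \<Longrightarrow> completes_to (gt f) {} (SF0 f, {}) (RF0 f)"
    and run: "if update_C gtC RC0 (\<Union>f\<in>F. const_rules (RF0 f)) \<noteq> RC0
      then update_loop F gtC gt (update_C gtC RC0 (\<Union>f\<in>F. const_rules (RF0 f))) RF0 RC RF
      else RC = RC0 \<and> RF = RF0"
    using assms(1) unfolding combination_mult_AC_def single_AC_completion_def RC0_def SF0_def k_def
    by blast
  define RC1 where "RC1 = update_C gtC RC0 (\<Union>f\<in>F. const_rules (RF0 f))"
  have cc: "canonical_consts RC0" unfolding canonical_consts_def RC0_def using assms(2) by blast
  \<comment> \<open>The constants in normal form under \<open>RC0\<close>. The input of the first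
    completion uses only these, and completion adds no others.\<close>
  define D0 where "D0 = {c \<in> D. const_nf RC0 c = c}"
  have kD0: "k M \<in> monomials D0" if "M \<in> monomials D" for M
    using that canonical_consts_props(3)[OF cc] const_nf_carrier[OF cc]
    unfolding k_def monomials_def D0_def by auto
  have SF0_D0: "SF0 f \<subseteq> monomials D0 \<times> monomials D0" if "f \<in> F" for f
    using kD0 assms(3)[OF that] unfolding SF0_def by auto
  have D0D: "monomials D0 \<subseteq> monomials D" unfolding D0_def monomials_def by auto
  have SF0_D: "SF0 f \<subseteq> monomials D \<times> monomials D" if "f \<in> F" for f
    using SF0_D0[OF that] D0D by blast
  have o0: "oriented D (gt f) {}" for f by (simp add: oriented_def)
  note s = completes_to_sound[OF adm RF0 SF0_D o0 o0]
  have o: "\<And>f. f \<in> F \<Longrightarrow> oriented D (gt f) (RF0 f)" using s(1) by blast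
  note c = update_C_sound[OF cc o, folded RC1_def]
  have inv: "loop_inv RC1 RF0" unfolding loop_inv_def
  proof (intro conjI ballI)
    show "canonical_consts RC1" using c(1) by blast
    fix f assume f: "f \<in> F"
    show "oriented D (gt f) (RF0 f)" using o f by blast
    show "case p of (c, d) \<Rightarrow> const_nf RC1 c = const_nf RC1 d"
      if "p \<in> const_rules (RF0 f)" for p
      using c(3) that f by (cases p) blast
    \<comment> \<open>The first completion runs without constant rules, so the empty system is the
      witness.\<close>
    show "\<exists>RC0. (\<forall>(c, d)\<in>RC0. const_nf RC1 c = const_nf RC1 d) \<and>
        (\<forall>(s, t)\<in>critical_pairs (RF0 f). joinable (RF0 f \<union> as_mono_rules RC0) s t)"
      using s(3)[OF f f f] by (intro exI[of _ "{}"]) (simp add: as_mono_rules_def)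
  qed
  have "models E SC SF \<longleftrightarrow> models E RC0 SF" for E
    using consts_hold_const_canonical[OF assms(2)] unfolding models_def RC0_def by blast
  also have "models E RC0 SF \<longleftrightarrow> models E RC0 SF0" for E
  proof -
    have "SF f \<subseteq> holds E f \<longleftrightarrow> SF0 f \<subseteq> holds E f" if f: "f \<in> F" and h: "consts_hold E RC0" for f
    proof -
      note H = mono_congruence_holds[OF f, of E]
      have symH: "sym (holds E f)" and transH: "trans (holds E f)"
        using H unfolding mono_congruence_def by blast+
      have k: "(M, k M) \<in> holds E f" if "M \<in> monomials D" for M
        using mono_congruence_rewrites[OF H as_mono_rules_holds[OF canonical_consts_props(1)[OF cc] h]
            _ rewrites_image_const_nf[OF cc] that] as_mono_rules_oriented[OF f cc]
        unfolding oriented_def k_def by blast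
      have "(A, B) \<in> holds E f \<longleftrightarrow> (k A, k B) \<in> holds E f" if "(A, B) \<in> SF f" for A B
      proof -
        have "A \<in> monomials D" "B \<in> monomials D" using assms(3)[OF f] that by auto
        then show ?thesis using k[of A] k[of B] symD[OF symH] transD[OF transH] by meson
      qed
      then show ?thesis unfolding SF0_def by (auto simp: map_prod_def)
    qed
    then show ?thesis unfolding models_def by blast
  qed
  also have "models E RC0 SF0 \<longleftrightarrow> models E RC0 RF0" for E
    using s(2)[OF _ _ _ mono_congruence_holds] unfolding models_def by simp
  finally have mod0: "models E SC SF \<longleftrightarrow> models E RC0 RF0" for E .
  have "final RC RF \<and> (models E RC0 RF0 \<longleftrightarrow> models E RC RF)"
  proof (cases "RC1 = RC0")
    case False
    then have "update_loop F gtC gt RC1 RF0 RC RF" using run unfolding RC1_def by simp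
    then show ?thesis using update_loop_sound[OF _ inv] c(2) by blast
  next
    case True
    \<comment> \<open>The loop is skipped, so no update has joined the pairs with
      \<open>RC0\<close>. All left sides lie over \<open>D0\<close>, hence every system counts as
      untouched, and the argument for untouched systems applies.\<close>
    then have eq: "RC = RC0" "RF = RF0" using run unfolding RC1_def by simp_all
    have "final RC0 RF0" unfolding final_def
    proof (intro conjI ballI)
      fix f assume f: "f \<in> F"
      show "oriented D (gt f) (RF0 f)" using o f by blast
      have "RF0 f \<subseteq> monomials D0 \<times> monomials D0"
        using completion_steps_monomials[of "gt f" "{}" "SF0 f" "{}" "{}" "RF0 f" D0] RF0[OF f] SF0_D0[OF f]
        unfolding completes_to_def by blast
      then have "\<not> needs_update RC0 (RF0 f)"
        using Domain_iff_const_nf[OF cc]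
        unfolding needs_update_def reducible_as_mono_rules D0_def monomials_def by fastforce
      note n = not_needs_update[OF inv[unfolded True] f this]
      show "const_rules (RF0 f) = {}" using n(1) .
      show "case p of (s, t) \<Rightarrow> joinable (RF0 f \<union> as_mono_rules RC0) s t"
        if "p \<in> critical_pairs (RF0 f \<union> as_mono_rules RC0)" for p
        using n(2) that by blast
    qed (rule cc)
    then show ?thesis using eq by simp
  qed
  then show "final RC RF" "models E SC SF \<longleftrightarrow> models E RC RF" using mod0 by blast+
qed

lemma final_combined:
  assumes "final RC RF"
  shows "combined D F RC RF (const_nf RC) (\<lambda>f. mono_nf (RF f \<union> as_mono_rules RC))"
proof -
  let ?K = "as_mono_rules RC"
  have cc: "canonical_consts RC" using assms unfolding final_def by blast
  have o: "oriented D (gt f) (RF f \<union> ?K)" if "f \<in> F" for f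
    using assms as_mono_rules_oriented[OF that cc] that unfolding final_def oriented_def by blast
  have cp: "\<forall>(s, t)\<in>critical_pairs (RF f \<union> ?K). joinable (RF f \<union> ?K) s t" if "f \<in> F" for f
    using assms that unfolding final_def by blast
  note nf = mono_nf[OF adm o cp]
  \<comment> \<open>A left side of size one is a constant. A nonconstant right side would exceed it,
    against the orientation; a constant right side would give a constant rule, which
    \<open>final\<close> excludes.\<close>
  have size2: "size A \<ge> 2" if f: "f \<in> F" and AB: "(A, B) \<in> RF f" for f A B
  proof (rule ccontr)
    assume "\<not> size A \<ge> 2"
    have m: "A \<in> monomials D" "B \<in> monomials D" "gt f A B"
      using o[OF f] AB unfolding oriented_def by auto
    then have "size A = 1" using \<open>\<not> size A \<ge> 2\<close> unfolding monomials_def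
      by (metis (mono_tags, lifting) One_nat_def Suc_1 Suc_leI le_neq_implies_less mem_Collect_eq
          nonempty_has_size not_less_eq_eq)
    then obtain c where c: "A = {#c#}" by (metis One_nat_def size_1_singleton_mset)
    show False
    proof (cases "size B \<ge> 2")
      case True
      then have "gt f B A" using nonconst[OF f] m c unfolding nonconstants_greater_def monomials_def by auto
      then show False using m admissible_trans[OF adm[OF f]] admissible_irrefl[OF adm[OF f]] by blast
    next
      case False
      then have "size B = 1" using m unfolding monomials_def
        by (metis (mono_tags, lifting) One_nat_def Suc_1 Suc_leI le_neq_implies_less mem_Collect_eq
            nonempty_has_size not_less_eq_eq)
      then obtain d where d: "B = {#d#}" by (metis One_nat_def size_1_singleton_mset)
      then have "(c, d) \<in> const_rules (RF f)" using AB c unfolding const_rules_def by simp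
      then show False using assms f unfolding final_def by blast
    qed
  qed
  show ?thesis
  proof (unfold_locales)
    show "RC \<subseteq> D \<times> D" using canonical_consts_props(1)[OF cc] .
    show "RF f \<subseteq> monomials D \<times> monomials D" if "f \<in> F" for f
      using o[OF that] unfolding oriented_def by blast
    show "size A \<ge> 2" if "f \<in> F" "(A, B) \<in> RF f" for f A B using size2 that by blast
    show "wf {(N, M). (M, N) \<in> mono_rewrite ((if f \<in> F then RF f else {}) \<union> ?K) \<and> set_mset M \<subseteq> D}" for f
    proof (cases "f \<in> F")
      case True
      then show ?thesis using wf_oriented[OF adm o] by simp
    next
      case False
      \<comment> \<open>No ordering is available outside \<open>F\<close>. Each constant rule
        replaces a reducible constant by an irreducible one, so counting the reducible ones
        suffices.\<close>
      have "{(N, M). (M, N) \<in> mono_rewrite ?K} \<subseteq> measure (\<lambda>M. size (filter_mset (\<lambda>c. c \<in> Domain RC) M))"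
      proof (safe, unfold in_measure)
        fix M N assume "(M, N) \<in> mono_rewrite ?K"
        then obtain c d Z where cd: "(c, d) \<in> RC" "M = {#c#} + Z" "N = {#d#} + Z"
          unfolding mono_rewrite_iff as_mono_rules_def by blast
        then have "c \<in> Domain RC" "d \<notin> Domain RC"
          using Domain_iff_const_nf[OF cc] canonical_consts_iff[OF cc] canonical_consts_props(3)[OF cc]
          by auto
        then show "size (filter_mset (\<lambda>c. c \<in> Domain RC) N) < size (filter_mset (\<lambda>c. c \<in> Domain RC) M)"
          using cd by simp
      qed
      then have "wf {(N, M). (M, N) \<in> mono_rewrite ?K}" using wf_subset wf_measure by blast
      then show ?thesis using False by (auto elim: wf_subset)
    qed
    show "(M, mono_nf (RF f \<union> ?K) M) \<in> (mono_rewrite ((if f \<in> F then RF f else {}) \<union> ?K))\<^sup>*"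
      if "f \<in> F" "set_mset M \<subseteq> D" for f M
      using nf(1)[OF that(1,1,1,2)] that by simp
    show "mono_nf (RF f \<union> ?K) M = mono_nf (RF f \<union> ?K) N"
      if "f \<in> F" "set_mset M \<subseteq> D" "(M, N) \<in> mono_rewrite ((if f \<in> F then RF f else {}) \<union> ?K)" for f M N
      using nf(4)[OF that(1,1,1,2)] that by simp
    show "const_nf RC c = c \<or> (c, const_nf RC c) \<in> RC" for c
      using canonical_consts_iff[OF cc, of c "const_nf RC c"] by auto
    show "const_nf RC c = const_nf RC d" if "(c, d) \<in> RC" for c d
      using that canonical_consts_iff[OF cc] canonical_consts_props(3)[OF cc] by auto
    show "mono_nf (RF f \<union> ?K) {#c#} = {#const_nf RC c#}" if f: "f \<in> F" and c: "c \<in> D" for f c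
    proof (rule nf(3)[OF f f f])
      show "set_mset {#c#} \<subseteq> D" using c by simp
      show "({#c#}, {#const_nf RC c#}) \<in> (mono_rewrite (RF f \<union> ?K))\<^sup>*"
        using rewrites_image_const_nf[OF cc, of "{#c#}"]
          rtrancl_mono[OF mono_rewrite_mono[of ?K "RF f \<union> ?K"]] by auto
      \<comment> \<open>Rules of \<open>RF f\<close> need at least two constants, so only a rule of
        \<open>RC\<close> could match, and a normalized constant is outside its domain.\<close>
      show "\<not> reducible (RF f \<union> ?K) {#const_nf RC c#}"
      proof
        assume "reducible (RF f \<union> ?K) {#const_nf RC c#}"
        then obtain A B where AB: "(A, B) \<in> RF f \<union> ?K" "A \<subseteq># {#const_nf RC c#}"
          unfolding reducible_def mono_rewrite_def by blast
        have "size A \<le> 1" using size_mset_mono[OF AB(2)] by simp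
        then have K: "(A, B) \<in> ?K" using AB(1) size2[OF f] by fastforce
        then have "reducible ?K {#const_nf RC c#}"
          using AB(2) unfolding reducible_def mono_rewrite_def by blast
        then show False using Domain_iff_const_nf[OF cc] canonical_consts_props(3)[OF cc]
          by (auto simp: reducible_as_mono_rules)
      qed
    qed
  qed
qed

text \<open>Each system is satisfied by the closure of its own term equations. With these as
  \<open>E\<close>, the assumed equivalence makes it a model of the other system as well, and
  leastness gives the inclusion.\<close>

lemma accc_term_eqs_eq:
  assumes "\<And>E. models E SC SF \<longleftrightarrow> models E RC RF"
    and "SC \<subseteq> D \<times> D" "\<And>f. f \<in> F \<Longrightarrow> SF f \<subseteq> monomials D \<times> monomials D"
    and "RC \<subseteq> D \<times> D" "\<And>f. f \<in> F \<Longrightarrow> RF f \<subseteq> monomials D \<times> monomials D"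
  shows "accc D F (term_eqs F SC SF) = accc D F (term_eqs F RC RF)"
proof -
  have self: "models (term_eqs F EC EF) EC EF"
    if "EC \<subseteq> D \<times> D" "\<And>f. f \<in> F \<Longrightarrow> EF f \<subseteq> monomials D \<times> monomials D" for EC EF
    unfolding models_def
  proof (intro conjI ballI)
    show "consts_hold (term_eqs F EC EF) EC"
      unfolding consts_hold_def using that(1)
      by (auto simp: term_eqs_def intro!: accc.eqn gterms.const)
    fix f assume f: "f \<in> F"
    show "EF f \<subseteq> holds (term_eqs F EC EF) f"
    proof (rule subrelI)
      fix A B assume AB: "(A, B) \<in> EF f"
      then have m: "A \<in> monomials D" "B \<in> monomials D" using that(2)[OF f] by auto
      have "(s, t) \<in> accc D F (term_eqs F EC EF)" if "mono_term f A s" "mono_term f B t" for s t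
        using that AB f m mono_term_gterms[OF that(1) f] mono_term_gterms[OF that(2) f]
        by (intro accc.eqn) (auto simp: term_eqs_def monomials_def)
      then show "(A, B) \<in> holds (term_eqs F EC EF) f" using m unfolding holds_def by blast
    qed
  qed
  have least: "accc D F (term_eqs F EC EF) \<subseteq> accc D F E" if m: "models E EC EF" for EC EF E
  proof (rule accc_least)
    fix s t assume "(s, t) \<in> term_eqs F EC EF"
    then consider (const) c d where "(c, d) \<in> EC" "s = Const c" "t = Const d"
      | (mono) f A B where "f \<in> F" "(A, B) \<in> EF f" "mono_term f A s" "mono_term f B t"
      unfolding term_eqs_def by blast
    then show "(s, t) \<in> accc D F E"
    proof cases
      case const
      then show ?thesis using m unfolding models_def consts_hold_def by blast
    next
      case mono
      then have "(A, B) \<in> holds E f" using m unfolding models_def by blast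
      then show ?thesis using mono unfolding holds_def by blast
    qed
  qed
  show ?thesis using least self assms by (metis subset_antisym)
qed

end

section \<open>Purification\<close>

primrec fsubs :: "('c, 'f) fterm \<Rightarrow> ('c, 'f) fterm set" where
  "fsubs (FConst c) = {FConst c}"
| "fsubs (FApp f M) = insert (FApp f M) (\<Union>(set_mset (image_mset fsubs M)))"

lemma finite_fsubs: "finite (fsubs x)"
  by (induction x) auto

lemma fsubs_self: "x \<in> fsubs x"
  by (cases x) auto

lemma fsubs_arg: "FApp f M \<in> fsubs x \<Longrightarrow> y \<in># M \<Longrightarrow> y \<in> fsubs x"
proof (induction x)
  case (FApp g N)
  then show ?case using fsubs_self[of y] by auto
qed simp

text \<open>Named terms are subterms of flattened input sides. Finiteness makes the extended set of
  constants finite, so every class of constants has a least element.\<close>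

lemma finite_named:
  assumes "finite S"
  shows "finite (named S)"
proof -
  have "x \<in> (\<Union>(s, t)\<in>S. fsubs (flatten s) \<union> fsubs (flatten t))" if "x \<in> named S" for x
    using that
  proof (induction rule: named.induct)
    case (left_arg s t f M g N)
    then have "FApp g N \<in> fsubs (flatten s)" using fsubs_arg fsubs_self by metis
    then show ?case using left_arg(1) by blast
  next
    case (right_arg s t f M g N)
    then have "FApp g N \<in> fsubs (flatten t)" using fsubs_arg fsubs_self by metis
    then show ?case using right_arg(1) by blast
  next
    case (mixed s t f M g N)
    then have "FApp g N \<in> fsubs (flatten t)" using fsubs_self by metis
    then show ?case using mixed(1) by blast
  next
    case (nested f M g N)
    then obtain p where "p \<in> S" "FApp f M \<in> fsubs (flatten (fst p)) \<union> fsubs (flatten (snd p))"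
      by auto
    then have "FApp g N \<in> fsubs (flatten (fst p)) \<union> fsubs (flatten (snd p))"
      using nested(2) fsubs_arg[of f M _ "FApp g N"] by auto
    then show ?case using \<open>p \<in> S\<close> by (cases p) auto
  qed
  then have "named S \<subseteq> (\<Union>(s, t)\<in>S. fsubs (flatten s) \<union> fsubs (flatten t))" by (rule subsetI)
  then show ?thesis by (rule finite_subset) (use assms finite_fsubs in auto)
qed

lemma flatten_args:
  assumes "flatten t = FApp f M"
  shows "M = image_mset flatten (gargs f t)"
  using assms flat_args_flatten[of f t] by simp

lemma flatten_arg_gterm:
  assumes "flatten t = FApp f M" "t \<in> gterms C F" "y \<in># M"
  obtains x where "x \<in># gargs f t" "x \<in> gterms C F" "flatten x = y"
  using assms flatten_args[OF assms(1)] gargs_gterms[OF assms(2), of f] by auto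

lemma flatten_arg_not_FApp: "flatten t = FApp f M \<Longrightarrow> FApp f N \<notin># M"
  using flatten_args[of t f M] gargs_not_App[of _ f t] flatten_eq_FApp
  by (metis (no_types, lifting) imageE set_image_mset)

locale purification =
  fixes C :: "'c set" and F :: "'f set" and S :: "('c, 'f) gterm rel"
    and u :: "('c, 'f) fterm \<Rightarrow> 'c"
  assumes S_gterms: "S \<subseteq> gterms C F \<times> gterms C F"
    and fresh: "fresh_naming C S u"
begin

abbreviation "D \<equiv> ext_consts C S u"
abbreviation "P \<equiv> term_eqs F (pure_consts S) (pure_monos u S)"

section \<open>Sides of purified equations\<close>

lemma named_gterm: "x \<in> named S \<Longrightarrow> \<exists>t\<in>gterms C F. flatten t = x"
proof (induction rule: named.induct)
  case (left_arg s t f M g N)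
  then have "s \<in> gterms C F" using S_gterms by auto
  then show ?case using flatten_arg_gterm[OF left_arg(2) _ left_arg(3)] by metis
next
  case (right_arg s t f M g N)
  then have "t \<in> gterms C F" using S_gterms by auto
  then show ?case using flatten_arg_gterm[OF right_arg(2) _ right_arg(3)] by metis
next
  case (mixed s t f M g N)
  then show ?case using S_gterms by auto
next
  case (nested f M g N)
  then obtain t where "t \<in> gterms C F" "flatten t = FApp f M" by blast
  then show ?case using flatten_arg_gterm[OF _ _ nested(2)] by metis
qed

lemma named_FApp: "x \<in> named S \<Longrightarrow> \<exists>f M. x = FApp f M"
  by (induction rule: named.induct) auto

definition args_named :: "('c, 'f) fterm \<Rightarrow> bool" where
  "args_named x \<longleftrightarrow> (\<forall>f M g N. x = FApp f M \<longrightarrow> FApp g N \<in># M \<longrightarrow> FApp g N \<in> named S)"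

text \<open>The flat terms for which \<open>mono_of u f\<close> is a faithful translation: a
  constant, an \<open>f\<close>-headed term with named nonconstant arguments, or a term with another
  head that has a name itself.\<close>

definition side_of :: "'f \<Rightarrow> ('c, 'f) fterm \<Rightarrow> bool" where
  "side_of f x \<longleftrightarrow> (\<exists>t\<in>gterms C F. flatten t = x) \<and> args_named x \<and>
    (\<forall>g M. x = FApp g M \<longrightarrow> g = f \<or> x \<in> named S)"

lemma args_named_equation: "(s, t) \<in> S \<Longrightarrow> args_named (flatten s) \<and> args_named (flatten t)"
  unfolding args_named_def using named.left_arg named.right_arg by metis

lemma args_named_named: "x \<in> named S \<Longrightarrow> args_named x"
  unfolding args_named_def using named.nested by metis

lemma side_of_equation:
  assumes "(s, t) \<in> S" "eq_symbol (flatten s) (flatten t) = Some f"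
  shows "side_of f (flatten s)" "side_of f (flatten t)" "f \<in> F"
proof -
  have g: "s \<in> gterms C F" "t \<in> gterms C F" using assms(1) S_gterms by auto
  show "side_of f (flatten s)"
    using assms(2) g args_named_equation[OF assms(1)] unfolding side_of_def
    by (cases "flatten s"; cases "flatten t") auto
  show "side_of f (flatten t)"
    using assms(2) g args_named_equation[OF assms(1)] named.mixed[OF assms(1)] unfolding side_of_def
    by (cases "flatten s"; cases "flatten t") auto
  show "f \<in> F"
  proof (cases "flatten s")
    case (FConst c)
    then obtain M where "flatten t = FApp f M" using assms(2) by (cases "flatten t") auto
    then show ?thesis using g flatten_eq_FApp gterms_AppD by metis
  next
    case (FApp g M)
    then show ?thesis using assms(2) g flatten_eq_FApp gterms_AppD
      by (metis eq_symbol.simps(1) option.inject)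
  qed
qed

lemma side_of_named: "FApp f M \<in> named S \<Longrightarrow> side_of f (FApp f M)"
  unfolding side_of_def using named_gterm args_named_named by blast

lemma arg_cases:
  assumes "t \<in> gterms C F" "flatten t = FApp f M" "args_named (FApp f M)" "y \<in># M"
  obtains (const) c where "c \<in> C" "y = FConst c" | (named) g N where "y = FApp g N" "y \<in> named S"
proof (cases y)
  case (FConst c)
  obtain x where "x \<in> gterms C F" "flatten x = y"
    using flatten_arg_gterm[OF assms(2,1,4)] by metis
  then have "c \<in> C" using FConst flatten_eq_FConst gterms_ConstD by metis
  then show ?thesis using FConst const by blast
next
  case (FApp g N)
  then show ?thesis using assms(3,4) named unfolding args_named_def by blast
qed

lemma u_carrier: "x \<in> named S \<Longrightarrow> u x \<in> D"
  unfolding ext_consts_def by blast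

lemma C_subset: "C \<subseteq> D"
  unfolding ext_consts_def by blast

lemma mono_of_monomials:
  assumes "side_of f x"
  shows "mono_of u f x \<in> monomials D"
proof -
  obtain t where t: "t \<in> gterms C F" "flatten t = x" and an: "args_named x"
    using assms unfolding side_of_def by blast
  show ?thesis
  proof (cases x)
    case (FConst c)
    then have "c \<in> C" using t flatten_eq_FConst gterms_ConstD by metis
    then show ?thesis using FConst C_subset by (auto simp: monomials_def)
  next
    case (FApp g M)
    show ?thesis
    proof (cases "g = f")
      case True
      have "const_of u y \<in> D" if "y \<in># M" for y
        using t(1) t(2)[unfolded FApp] an[unfolded FApp] that
        by (cases rule: arg_cases) (use C_subset u_carrier in auto)
      moreover have "M \<noteq> {#}"
        using flatten_args[OF t(2)[unfolded FApp]] tree_nonempty[OF tree_gargs[of g t]] by auto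
      ultimately show ?thesis using FApp True by (auto simp: monomials_def)
    next
      case False
      then have "x \<in> named S" using assms FApp unfolding side_of_def by blast
      then show ?thesis using FApp False u_carrier by (auto simp: monomials_def)
    qed
  qed
qed

lemma pure_monos_monomials: "pure_monos u S f \<subseteq> monomials D \<times> monomials D"
  using mono_of_monomials[OF side_of_equation(1)] mono_of_monomials[OF side_of_equation(2)]
    mono_of_monomials[OF side_of_named] u_carrier
  unfolding pure_monos_def by (fastforce simp: monomials_def)

lemma pure_consts_carrier: "pure_consts S \<subseteq> C \<times> C"
proof (rule subrelI)
  fix c d assume "(c, d) \<in> pure_consts S"
  then have "Const c \<in> gterms C F" "Const d \<in> gterms C F"
    using S_gterms unfolding pure_consts_def by auto
  then show "(c, d) \<in> C \<times> C" by (auto dest: gterms_ConstD)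
qed

section \<open>Replacing fresh constants by the terms they name\<close>

definition unname :: "'c \<Rightarrow> ('c, 'f) gterm" where
  "unname c = (if c \<in> C then Const c
    else SOME t. t \<in> gterms C F \<and> flatten t \<in> named S \<and> u (flatten t) = c)"

primrec expand :: "('c, 'f) gterm \<Rightarrow> ('c, 'f) gterm" where
  "expand (Const c) = unname c"
| "expand (App f s t) = App f (expand s) (expand t)"

text \<open>Fresh constants name flat terms, that is, AC classes. The choice in
  \<open>unname\<close> fixes some bracketing, and injectivity of \<open>u\<close> recovers the
  class.\<close>

lemma unname_named:
  assumes "x \<in> named S"
  shows "unname (u x) \<in> gterms C F" "flatten (unname (u x)) = x"
proof -
  have nC: "u x \<notin> C" and inj: "inj_on u (named S)" using fresh assms unfolding fresh_naming_def by auto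
  obtain t where "t \<in> gterms C F" "flatten t = x" using named_gterm[OF assms] by blast
  then have "\<exists>t. t \<in> gterms C F \<and> flatten t \<in> named S \<and> u (flatten t) = u x" using assms by blast
  then have b: "unname (u x) \<in> gterms C F" "flatten (unname (u x)) \<in> named S"
      "u (flatten (unname (u x))) = u x"
    using someI_ex[of "\<lambda>t. t \<in> gterms C F \<and> flatten t \<in> named S \<and> u (flatten t) = u x"] nC unfolding unname_def by auto
  show "unname (u x) \<in> gterms C F" by fact
  show "flatten (unname (u x)) = x" using inj_onD[OF inj b(3) b(2) assms] .
qed

lemma unname_C: "c \<in> C \<Longrightarrow> unname c = Const c"
  by (simp add: unname_def)

lemma expand_gterms: "t \<in> gterms D F \<Longrightarrow> expand t \<in> gterms C F"
proof (induction rule: gterms.induct)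
  case (const c)
  then show ?case using unname_named(1) unname_C unfolding ext_consts_def by (auto intro: gterms.const)
qed (auto intro: gterms.app)

lemma expand_id: "t \<in> gterms C F \<Longrightarrow> expand t = t"
  by (induction rule: gterms.induct) (auto simp: unname_C)

lemma expand_mono_term_flat_args:
  "mono_term f A l \<Longrightarrow> flat_args f (flatten (expand l)) = (\<Sum>c\<in>#A. flat_args f (flatten (unname c)))"
  by (induction rule: mono_term.induct) auto

text \<open>Inverts purification up to flattening: an argument of an \<open>f\<close>-headed flat
  term is never \<open>f\<close>-headed, so putting it back does not merge it into the
  layer.\<close>

lemma expand_mono_of:
  assumes "side_of f x" "mono_term f (mono_of u f x) l"
  shows "flatten (expand l) = x"
proof -
  obtain t where t: "t \<in> gterms C F" "flatten t = x" and an: "args_named x"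
    using assms unfolding side_of_def by blast
  show ?thesis
  proof (cases x)
    case (FConst c)
    then have "c \<in> C" using t flatten_eq_FConst gterms_ConstD by metis
    then show ?thesis using FConst assms(2) by (simp add: mono_term_singleton unname_C)
  next
    case (FApp g M)
    show ?thesis
    proof (cases "g = f")
      case True
      then have t': "flatten t = FApp f M" using FApp t by simp
      have "flat_args f (flatten (unname (const_of u y))) = {#y#}" if "y \<in># M" for y
        using t(1) t' an[unfolded FApp True] that
      proof (cases rule: arg_cases)
        case (named h N)
        then have "h \<noteq> f" using flatten_arg_not_FApp[OF t'] that by blast
        then show ?thesis using named unname_named(2)[OF named(2)] by simp
      qed (simp add: unname_C)
      then have "(\<Sum>y\<in>#M. flat_args f (flatten (unname (const_of u y)))) = (\<Sum>y\<in>#M. {#y#})"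
        by (intro arg_cong[where f = sum_mset] image_mset_cong) auto
      then have "flat_args f (flatten (expand l)) = M"
        using expand_mono_term_flat_args[OF assms(2)] FApp True
        by (simp add: image_mset.compositionality comp_def)
      then have "flatten (expand l) = pack f M" using flatten_pack by metis
      also have "\<dots> = x" using flatten_pack[of t f] t' FApp True by simp
      finally show ?thesis .
    next
      case False
      then have "x \<in> named S" using assms FApp unfolding side_of_def by blast
      then show ?thesis using FApp False assms(2) unname_named(2) by (simp add: mono_term_singleton)
    qed
  qed
qed

lemma pure_monos_cases:
  assumes "(A, B) \<in> pure_monos u S f"
  obtains (equation) s t where "(s, t) \<in> S" "eq_symbol (flatten s) (flatten t) = Some f"
      "A = mono_of u f (flatten s)" "B = mono_of u f (flatten t)"
    | (naming) M where "FApp f M \<in> named S" "A = mono_of u f (FApp f M)" "B = {#u (FApp f M)#}"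
  using assms unfolding pure_monos_def by blast

text \<open>\<open>expand\<close> commutes with \<open>App\<close>, so only the equations matter: a
  naming equation becomes an AC identity, and a translated equation becomes its original modulo
  AC.\<close>

lemma expand_accc:
  "(s, t) \<in> accc D F P \<Longrightarrow> (expand s, expand t) \<in> accc C F S"
proof (induction rule: accc.induct)
  case (eqn s t)
  then consider (const) c d where "(c, d) \<in> pure_consts S" "s = Const c" "t = Const d"
    | (mono) f A B where "f \<in> F" "(A, B) \<in> pure_monos u S f" "mono_term f A s" "mono_term f B t"
    unfolding term_eqs_def by blast
  then show ?case
  proof cases
    case const
    then show ?thesis using pure_consts_carrier unfolding pure_consts_def
      by (auto simp: unname_C intro!: accc.eqn gterms.const)
  next
    case mono
    note g = expand_gterms[OF eqn(2)] expand_gterms[OF eqn(3)]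
    show ?thesis using mono(2)
    proof (cases rule: pure_monos_cases)
      case (equation s0 t0)
      note side = side_of_equation[OF equation(1,2)]
      have g0: "s0 \<in> gterms C F" "t0 \<in> gterms C F" using equation(1) S_gterms by auto
      have "(expand s, s0) \<in> accc C F S"
        using expand_mono_of[OF side(1)] mono(3) equation g g0 flatten_eq_accc by metis
      moreover have "(t0, expand t) \<in> accc C F S"
        using expand_mono_of[OF side(2)] mono(4) equation g g0 flatten_eq_accc by metis
      moreover have "(s0, t0) \<in> accc C F S" using equation(1) g0 by (auto intro: accc.eqn)
      ultimately show ?thesis using accc.trans by blast
    next
      case (naming M)
      have "flatten (expand s) = FApp f M"
        using expand_mono_of[OF side_of_named] naming mono(3) by metis
      moreover have "flatten (expand t) = FApp f M"
        using mono(4) naming unname_named(2) by (simp add: mono_term_singleton)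
      ultimately show ?thesis using g flatten_eq_accc by metis
    qed
  qed
next
  case (trans s t v)
  then show ?case using accc.trans by blast
qed (auto intro: accc.comm accc.assoc accc.refl accc.sym accc.cong expand_gterms)

section \<open>Deriving the original equations from the purified ones\<close>

lemma args_accc:
  assumes "t \<in> gterms C F" "flatten t = FApp f M"
    and args: "\<And>x. x \<in># gargs f t \<Longrightarrow> (x, Const (const_of u (flatten x))) \<in> accc D F P"
    and l: "mono_term f (mono_of u f (FApp f M)) l"
  shows "(t, l) \<in> accc D F P"
proof -
  have f: "f \<in> F" using assms flatten_eq_FApp gterms_AppD by metis
  let ?B = "image_mset Const (image_mset (const_of u) M) :: ('c, 'f) gterm multiset"
  \<comment> \<open>Reads off the constant of a leaf; the leaves in \<open>?B\<close> are all
    constants, so the default is never reached.\<close>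
  let ?\<psi> = "\<lambda>t :: ('c, 'f) gterm. case t of Const c \<Rightarrow> c | App _ _ _ \<Rightarrow> undefined"
  note M = flatten_args[OF assms(2)]
  have tl: "tree f ?B l" using l by (simp add: mono_term_iff_tree)
  show ?thesis
  proof (rule tree_equiv[OF tree_gargs[of f t] tl f, where \<phi> = "\<lambda>x. const_of u (flatten x)" and \<psi> = ?\<psi>])
    show "set_mset (gargs f t) \<subseteq> gterms D F"
      using gargs_gterms[OF gterms_mono[OF assms(1) C_subset]] .
    have "Const (const_of u (flatten x)) \<in> gterms D F" if "x \<in># gargs f t" for x
      using args[OF that] accc_gterms by metis
    then show "set_mset ?B \<subseteq> gterms D F" using M by auto
    show "image_mset (\<lambda>x. const_of u (flatten x)) (gargs f t) = image_mset ?\<psi> ?B"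
      using M by (simp add: image_mset.compositionality comp_def)
    show "(x, y) \<in> accc D F P"
      if "x \<in># gargs f t" "y \<in># ?B" "const_of u (flatten x) = ?\<psi> y" for x y
      using that args[OF that(1)] by auto
  qed
qed

text \<open>By induction on size the named arguments equal their constants, which turns the term
  into the monomial on the left of its own naming equation.\<close>

lemma naming_accc:
  "t \<in> gterms C F \<Longrightarrow> flatten t \<in> named S \<Longrightarrow> (t, Const (u (flatten t))) \<in> accc D F P"
proof (induction "size t" arbitrary: t rule: less_induct)
  case less
  obtain f M where fM: "flatten t = FApp f M" using named_FApp[OF less.prems(2)] by blast
  then obtain a b where ab: "t = App f a b" using flatten_eq_FApp by metis
  have f: "f \<in> F" using ab less.prems(1) gterms_AppD by metis
  have args: "(x, Const (const_of u (flatten x))) \<in> accc D F P" if x: "x \<in># gargs f t" for x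
  proof -
    have gx: "x \<in> gterms C F" using x gargs_gterms[OF less.prems(1), of f] by blast
    have sz: "size x < size t"
      using x ab gargs_size[of x f a] gargs_size[of x f b] by auto
    have "flatten x \<in># M" using x flatten_args[OF fM] by simp
    with less.prems(1) fM args_named_named[OF less.prems(2), unfolded fM] show ?thesis
    proof (cases rule: arg_cases)
      case (const c)
      then have "x = Const c" using flatten_eq_FConst by metis
      then show ?thesis using const C_subset by (auto intro!: accc.refl gterms.const)
    next
      case (named g N)
      then show ?thesis using less.hyps[OF sz gx named(2)] by simp
    qed
  qed
  have m: "mono_of u f (FApp f M) \<in> monomials D"
    using mono_of_monomials[OF side_of_named] less.prems(2) fM by metis
  then obtain l where l: "mono_term f (mono_of u f (FApp f M)) l"
    using mono_term_exists[of "mono_of u f (FApp f M)" f] unfolding monomials_def by auto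
  have "(t, l) \<in> accc D F P" using args_accc[OF less.prems(1) fM args l] .
  moreover have "(l, Const (u (FApp f M))) \<in> accc D F P"
  proof (rule accc.eqn)
    have "(mono_of u f (FApp f M), {#u (FApp f M)#}) \<in> pure_monos u S f"
      using less.prems(2) fM unfolding pure_monos_def by auto
    then show "(l, Const (u (FApp f M))) \<in> P"
      using f l mono_term.const[of f "u (FApp f M)"] unfolding term_eqs_def by blast
    show "l \<in> gterms D F" using mono_term_gterms[OF l f] m unfolding monomials_def by blast
    show "Const (u (FApp f M)) \<in> gterms D F"
      using u_carrier less.prems(2) fM by (auto intro: gterms.const)
  qed
  ultimately show ?case using fM accc.trans by metis
qed

lemma side_accc:
  assumes "t \<in> gterms C F" "side_of f (flatten t)" "mono_term f (mono_of u f (flatten t)) l"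
  shows "(t, l) \<in> accc D F P"
proof (cases "flatten t")
  case (FConst c)
  then have "t = Const c" "l = Const c" using assms(3)
    by (auto simp: mono_term_singleton flatten_eq_FConst)
  then show ?thesis using gterms_mono[OF assms(1) C_subset] by (auto intro: accc.refl)
next
  case (FApp g M)
  show ?thesis
  proof (cases "g = f")
    case True
    then have fM: "flatten t = FApp f M" using FApp by simp
    have an: "args_named (FApp f M)" using assms(2) fM unfolding side_of_def by metis
    have "(x, Const (const_of u (flatten x))) \<in> accc D F P" if x: "x \<in># gargs f t" for x
    proof -
      have gx: "x \<in> gterms C F" using x gargs_gterms[OF assms(1), of f] by blast
      have "flatten x \<in># M" using x flatten_args[OF fM] by simp
      with assms(1) fM an show ?thesis
      proof (cases rule: arg_cases)
        case (const c)
        then have "x = Const c" using flatten_eq_FConst by metis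
        then show ?thesis using const C_subset by (auto intro!: accc.refl gterms.const)
      next
        case (named g N)
        then show ?thesis using naming_accc[OF gx named(2)] by simp
      qed
    qed
    then show ?thesis using args_accc[OF assms(1) fM] assms(3) fM by simp
  next
    case False
    then have "flatten t \<in> named S" using assms(2) FApp unfolding side_of_def by blast
    then show ?thesis using naming_accc[OF assms(1)] assms(3) FApp False
      by (simp add: mono_term_singleton)
  qed
qed

text \<open>Both sides are equal to their purified forms, and those are linked by the translated
  equation.\<close>

lemma equation_accc:
  assumes "(s, t) \<in> S"
  shows "(s, t) \<in> accc D F P"
proof -
  have g: "s \<in> gterms C F" "t \<in> gterms C F" using assms S_gterms by auto
  show ?thesis
  proof (cases "eq_symbol (flatten s) (flatten t)")
    case None
    then obtain c d where "flatten s = FConst c" "flatten t = FConst d"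
      by (cases "flatten s"; cases "flatten t") auto
    then have "s = Const c" "t = Const d" using flatten_eq_FConst by metis+
    then have "(s, t) \<in> P" using assms unfolding term_eqs_def pure_consts_def by blast
    then show ?thesis using g gterms_mono[OF _ C_subset] by (auto intro: accc.eqn)
  next
    case (Some f)
    note side = side_of_equation[OF assms Some]
    note m = mono_of_monomials[OF side(1)] mono_of_monomials[OF side(2)]
    obtain l r where l: "mono_term f (mono_of u f (flatten s)) l"
      and r: "mono_term f (mono_of u f (flatten t)) r"
      using mono_term_exists[of "mono_of u f (flatten s)" f]
        mono_term_exists[of "mono_of u f (flatten t)" f] m
      unfolding monomials_def by auto
    have "(mono_of u f (flatten s), mono_of u f (flatten t)) \<in> pure_monos u S f"
      using assms Some unfolding pure_monos_def by blast
    then have "(l, r) \<in> P" using l r side(3) unfolding term_eqs_def by blast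
    then have "(l, r) \<in> accc D F P"
      using mono_term_gterms[OF l side(3)] mono_term_gterms[OF r side(3)] m
      unfolding monomials_def by (blast intro: accc.eqn)
    then show ?thesis
      using side_accc[OF g(1) side(1) l] side_accc[OF g(2) side(2) r] accc.trans accc.sym by metis
  qed
qed

theorem accc_restrict: "accc D F P \<inter> (gterms C F \<times> gterms C F) = accc C F S"
proof (intro equalityI subrelI)
  fix s t assume "(s, t) \<in> accc D F P \<inter> (gterms C F \<times> gterms C F)"
  then show "(s, t) \<in> accc C F S" using expand_accc[of s t] expand_id by auto
next
  fix s t assume st: "(s, t) \<in> accc C F S"
  then have "(s, t) \<in> accc D F P"
  proof (induction rule: accc.induct)
    case (eqn s t)
    then show ?case using equation_accc by blast
  next
    case (trans s t v)
    then show ?case using accc.trans by blast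
  qed (auto intro: accc.comm accc.assoc accc.refl accc.sym accc.cong gterms_mono[OF _ C_subset])
  then show "(s, t) \<in> accc D F P \<inter> (gterms C F \<times> gterms C F)" using st accc_gterms by blast
qed

end

theorem theorem7p1:
  fixes C :: "'c set" and F :: "'f set"
    and S :: "('c, 'f) gterm rel"
    and u :: "('c, 'f) fterm \<Rightarrow> 'c"
    and gtC :: "'c \<Rightarrow> 'c \<Rightarrow> bool"
    and gt :: "'f \<Rightarrow> 'c multiset \<Rightarrow> 'c multiset \<Rightarrow> bool"
    and RC :: "'c rel" and RF :: "'f \<Rightarrow> 'c mono_eqs"
  assumes "finite C" and "finite F"
    and "finite S" and "S \<subseteq> gterms C F \<times> gterms C F"
    and "fresh_naming C S u"
    and "strict_total_on (ext_consts C S u) gtC"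
    and "\<And>f. f \<in> F \<Longrightarrow> admissible (ext_consts C S u) gtC (gt f)"
    and "\<And>f. f \<in> F \<Longrightarrow> nonconstants_greater (ext_consts C S u) (gt f)"
    and "combination_mult_AC F gtC gt (pure_consts S) (pure_monos u S) RC RF"
  shows "canonical (ext_consts C S u) F (term_eqs F RC RF) \<and>
    ac_conversion (ext_consts C S u) F (term_eqs F RC RF) =
      accc (ext_consts C S u) F (term_eqs F (pure_consts S) (pure_monos u S)) \<and>
    accc (ext_consts C S u) F (term_eqs F RC RF) \<inter> (gterms C F \<times> gterms C F) = accc C F S"
proof -
  let ?D = "ext_consts C S u"
  interpret p: purification C F S u using assms(4,5) by unfold_locales
  have "finite ?D" using assms(1) finite_named[OF assms(3)] unfolding ext_consts_def by blast
  then interpret c: combination ?D F gtC gt using assms(6-8) by unfold_locales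
  have SC: "pure_consts S \<subseteq> ?D \<times> ?D" using p.pure_consts_carrier p.C_subset by blast
  note sound = c.combination_mult_AC_sound[OF assms(9) SC p.pure_monos_monomials]
  interpret r: combined ?D F RC RF "const_nf RC" "\<lambda>f. mono_nf (RF f \<union> as_mono_rules RC)"
      "\<lambda>f. (if f \<in> F then RF f else {}) \<union> as_mono_rules RC"
      "\<lambda>f. {(N, M). (M, N) \<in> mono_rewrite ((if f \<in> F then RF f else {}) \<union> as_mono_rules RC) \<and>
        set_mset M \<subseteq> ?D}"
    using c.final_combined[OF sound(1)] by simp_all
  have "accc ?D F (term_eqs F (pure_consts S) (pure_monos u S)) = accc ?D F (term_eqs F RC RF)"
    using c.accc_term_eqs_eq[OF sound(2) SC p.pure_monos_monomials r.RC_carrier r.RF_carrier] .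
  then show ?thesis
    using r.terminating r.confluent p.accc_restrict
    unfolding canonical_def ac_conversion_eq_accc by simp
qed

end
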